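(* Let $v:\mathbb{Z}\to\mathbb{R}$ be a bounded sequence and let $H_v:\ell^2(\mathbb{Z})\to\ell^2(\mathbb{Z})$ be the Schrödinger operator $(H_v\psi)_n=\psi_{n+1}+\psi_{n-1}+v(n)\psi_n$. For $E\in\mathbb{R}$ let $A^{(E-v)}:\mathbb{Z}\to\mathrm{SL}(2,\mathbb{R})$ be given by $A^{(E-v)}(j)=\begin{pmatrix}E-v(j)&-1\\1&0\end{pmatrix}$. Then the spectrum of $H_v$ is $$\sigma(H_v)=\{E\in\mathbb{R}: A^{(E-v)}\text{ is not uniformly hyperbolic}\}.$$
   Context: For $A:\mathbb{Z}\to\mathrm{SL}(2,\mathbb{R})$ and $j\in\mathbb{Z}$ set $A_n(j)=A(j+n-1)\cdots A(j)$ for $n\ge1$, $A_0(j)=I_2$, and $A_n(j)=A(j+n)^{-1}\cdots A(j-1)^{-1}$ for $n\le-1$. $\mathbb{RP}^1=\mathbb{R}/(\pi\mathbb{Z})$ is the set of lines through the origin of $\mathbb{R}^2$ (identified with angles), $B\cdot\theta$ is the induced action of $B\in\mathrm{SL}(2,\mathbb{R})$, and $\vec v\in\theta$ means $\vec v$ lies on the line $\theta$. $A$ is called uniformly hyperbolic if there are maps $u,s:\mathbb{Z}\to\mathbb{RP}^1$ such that (1) $A(j)\cdot u(j)=u(j+1)$ and $A(j)\cdot s(j)=s(j+1)$ for all $j\in\mathbb{Z}$; (2) there exist $C>0$, $\lambda>1$ such that $\|A_{-n}(j)\vec v\|\le C\lambda^{-n}$ and $\|A_n(j)\vec w\|\le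 C\lambda^{-n}$ for all $n\ge1$, all $j\in\mathbb{Z}$ and all unit vectors $\vec v\in u(j)$, $\vec w\in s(j)$. *)

theory Defs
  imports "HOL-Analysis.Analysis"
begin

text \<open>The space is complex, as usual in spectral theory: elements of \<open>ell2\<close> are
  two-sided sequences of complex numbers.\<close>

definition ell2 :: "(int \<Rightarrow> complex) set" where
  "ell2 = {\<psi>. (\<lambda>n. (cmod (\<psi> n))\<^sup>2) summable_on UNIV}"

definition ell2_norm :: "(int \<Rightarrow> complex) \<Rightarrow> real" where
  "ell2_norm \<psi> = sqrt (\<Sum>\<^sub>\<infinity>n. (cmod (\<psi> n))\<^sup>2)"

text \<open>Operators on \<open>ell2\<close> are represented by maps on all sequences; only the values on
  \<open>ell2\<close> are relevant.\<close>

definition bounded_ell2_operator :: "((int \<Rightarrow> complex) \<Rightarrow> (int \<Rightarrow> complex)) \<Rightarrow> bool" where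
  "bounded_ell2_operator T \<longleftrightarrow>
     (\<forall>\<psi>\<in>ell2. T \<psi> \<in> ell2) \<and>
     (\<forall>\<phi>\<in>ell2. \<forall>\<psi>\<in>ell2. T (\<lambda>n. \<phi> n + \<psi> n) = (\<lambda>n. T \<phi> n + T \<psi> n)) \<and>
     (\<forall>c. \<forall>\<psi>\<in>ell2. T (\<lambda>n. c * \<psi> n) = (\<lambda>n. c * T \<psi> n)) \<and>
     (\<exists>K. \<forall>\<psi>\<in>ell2. ell2_norm (T \<psi>) \<le> K * ell2_norm \<psi>)"

text \<open>The complement of the set of \<open>z\<close> for which \<open>T - z\<close> has a bounded
  two-sided inverse \<open>R\<close>.\<close>

definition ell2_spectrum :: "((int \<Rightarrow> complex) \<Rightarrow> (int \<Rightarrow> complex)) \<Rightarrow> complex set" where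
  "ell2_spectrum T = {z. \<not> (\<exists>R. bounded_ell2_operator R \<and>
     (\<forall>\<psi>\<in>ell2. R (\<lambda>n. T \<psi> n - z * \<psi> n) = \<psi>) \<and>
     (\<forall>\<psi>\<in>ell2. (\<lambda>n. T (R \<psi>) n - z * R \<psi> n) = \<psi>))}"

definition schroedinger_op :: "(int \<Rightarrow> real) \<Rightarrow> (int \<Rightarrow> complex) \<Rightarrow> (int \<Rightarrow> complex)" where
  "schroedinger_op v \<psi> = (\<lambda>n. \<psi> (n + 1) + \<psi> (n - 1) + complex_of_real (v n) * \<psi> n)"

lemma ell2_shift:
  fixes \<psi> :: "int \<Rightarrow> complex" and k :: int
  shows "(\<lambda>n. (cmod (\<psi> (n + k)))\<^sup>2) summable_on UNIV \<longleftrightarrow> \<psi> \<in> ell2"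
    and "(\<Sum>\<^sub>\<infinity>n. (cmod (\<psi> (n + k)))\<^sup>2) = (\<Sum>\<^sub>\<infinity>n. (cmod (\<psi> n))\<^sup>2)"
proof -
  have b: "bij_betw (\<lambda>n::int. n + k) UNIV UNIV"
    by (rule bij_betwI[where g = "\<lambda>n. n - k"]) auto
  show "(\<lambda>n. (cmod (\<psi> (n + k)))\<^sup>2) summable_on UNIV \<longleftrightarrow> \<psi> \<in> ell2"
    unfolding ell2_def mem_Collect_eq
    by (rule summable_on_reindex_bij_betw[OF b, where f = "\<lambda>n. (cmod (\<psi> n))\<^sup>2"])
  show "(\<Sum>\<^sub>\<infinity>n. (cmod (\<psi> (n + k)))\<^sup>2) = (\<Sum>\<^sub>\<infinity>n. (cmod (\<psi> n))\<^sup>2)"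
    by (rule infsum_reindex_bij_betw[OF b, where f = "\<lambda>n. (cmod (\<psi> n))\<^sup>2"])
qed

lemma bounded_schroedinger_op:
  assumes "bounded (range v)"
  shows "bounded_ell2_operator (schroedinger_op v)"
proof -
  obtain B where B: "\<And>n. \<bar>v n\<bar> \<le> B"
    using assms unfolding bounded_iff by auto
  have *: "schroedinger_op v \<psi> \<in> ell2 \<and>
      ell2_norm (schroedinger_op v \<psi>) \<le> sqrt (6 + 3 * B\<^sup>2) * ell2_norm \<psi>"
    if \<psi>: "\<psi> \<in> ell2" for \<psi>
  proof -
    define q where "q = (\<lambda>n. (cmod (\<psi> n))\<^sup>2)"
    define g where "g = (\<lambda>n. 3 * (q (n + 1) + q (n + (-1)) + B\<^sup>2 * q n))"
    have s: "(\<lambda>n. q (n + k)) summable_on UNIV" for k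
      using ell2_shift(1)[of \<psi> k] \<psi> by (simp add: q_def)
    have s0: "q summable_on UNIV"
      using s[of 0] by simp
    have i: "infsum (\<lambda>n. q (n + k)) UNIV = infsum q UNIV" for k
      using ell2_shift(2)[of \<psi> k] by (simp add: q_def)
    have gs: "g summable_on UNIV"
      unfolding g_def by (intro summable_on_cmult_right summable_on_add s s0)
    have gi: "infsum g UNIV = (6 + 3 * B\<^sup>2) * infsum q UNIV"
      unfolding g_def
      by (simp only: infsum_cmult_right' infsum_add summable_on_add s s0 i
            summable_on_cmult_right) (simp add: algebra_simps)
    have le: "(cmod (schroedinger_op v \<psi> n))\<^sup>2 \<le> g n" for n
    proof -
      define a b c where "a = cmod (\<psi> (n + 1))" and "b = cmod (\<psi> (n + (-1)))"
        and "c = \<bar>v n\<bar> * cmod (\<psi> n)"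
      have "cmod (schroedinger_op v \<psi> n) \<le> a + b + c"
        unfolding schroedinger_op_def a_def b_def c_def
        by (rule order_trans[OF norm_triangle_ineq])
           (simp add: norm_mult norm_triangle_ineq)
      then have "(cmod (schroedinger_op v \<psi> n))\<^sup>2 \<le> (a + b + c)\<^sup>2"
        by (rule power_mono) simp
      also have "\<dots> \<le> 3 * (a\<^sup>2 + b\<^sup>2 + c\<^sup>2)"
      proof -
        have "0 \<le> (a - b)\<^sup>2 + (b - c)\<^sup>2 + (a - c)\<^sup>2" by simp
        then show ?thesis by (simp add: power2_eq_square algebra_simps)
      qed
      also have "c\<^sup>2 \<le> B\<^sup>2 * q n"
        unfolding c_def q_def power_mult_distrib
        by (intro mult_right_mono power_mono B) auto
      finally show ?thesis by (simp add: g_def a_def b_def q_def)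
    qed
    have fs: "(\<lambda>n. (cmod (schroedinger_op v \<psi> n))\<^sup>2) summable_on UNIV"
      by (rule summable_on_comparison_test[OF gs]) (auto simp: le)
    have "(\<Sum>\<^sub>\<infinity>n. (cmod (schroedinger_op v \<psi> n))\<^sup>2) \<le> infsum g UNIV"
      by (rule infsum_mono[OF fs gs]) (auto simp: le)
    then have "ell2_norm (schroedinger_op v \<psi>) \<le> sqrt (6 + 3 * B\<^sup>2) * ell2_norm \<psi>"
      unfolding ell2_norm_def real_sqrt_mult[symmetric] gi q_def by simp
    with fs show ?thesis by (simp add: ell2_def)
  qed
  then have "\<exists>K. \<forall>\<psi>\<in>ell2. ell2_norm (schroedinger_op v \<psi>) \<le> K * ell2_norm \<psi>"
    by blast
  moreover have "\<forall>\<psi>\<in>ell2. schroedinger_op v \<psi> \<in> ell2"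
    using * by blast
  ultimately show ?thesis
    unfolding bounded_ell2_operator_def
    by (intro conjI) (auto simp: schroedinger_op_def fun_eq_iff algebra_simps)
qed

definition SL2R :: "(real^2^2) set" where
  "SL2R = {B. det B = 1}"

definition RP1 :: "(real^2) set set" where
  "RP1 = {L. subspace L \<and> dim L = 1}"

definition line_action :: "real^2^2 \<Rightarrow> (real^2) set \<Rightarrow> (real^2) set" where
  "line_action B L = (\<lambda>x. B *v x) ` L"

fun forward_iterate :: "(int \<Rightarrow> real^2^2) \<Rightarrow> nat \<Rightarrow> int \<Rightarrow> real^2^2" where
  "forward_iterate A 0 j = mat 1"
| "forward_iterate A (Suc n) j = A (j + int n) ** forward_iterate A n j"

fun backward_iterate :: "(int \<Rightarrow> real^2^2) \<Rightarrow> nat \<Rightarrow> int \<Rightarrow> real^2^2" where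
  "backward_iterate A 0 j = mat 1"
| "backward_iterate A (Suc n) j = matrix_inv (A (j - int (Suc n))) ** backward_iterate A n j"

definition iterate :: "(int \<Rightarrow> real^2^2) \<Rightarrow> int \<Rightarrow> int \<Rightarrow> real^2^2" where
  "iterate A n j =
     (if 0 \<le> n then forward_iterate A (nat n) j else backward_iterate A (nat (- n)) j)"

text \<open>The notion is meant for sequences \<open>A\<close> with values in \<open>SL2R\<close>.\<close>

definition uniformly_hyperbolic :: "(int \<Rightarrow> real^2^2) \<Rightarrow> bool" where
  "uniformly_hyperbolic A \<longleftrightarrow>
     (\<exists>u s. (\<forall>j. u j \<in> RP1 \<and> s j \<in> RP1) \<and>
       (\<forall>j. line_action (A j) (u j) = u (j + 1) \<and> line_action (A j) (s j) = s (j + 1)) \<and>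
       (\<exists>C lam. C > 0 \<and> lam > 1 \<and>
         (\<forall>n\<ge>1. \<forall>j.
            (\<forall>x\<in>u j. norm x = 1 \<longrightarrow> norm (iterate A (- n) j *v x) \<le> C * lam powi (- n)) \<and>
            (\<forall>y\<in>s j. norm y = 1 \<longrightarrow> norm (iterate A n j *v y) \<le> C * lam powi (- n)))))"

definition schroedinger_cocycle :: "real \<Rightarrow> (int \<Rightarrow> real) \<Rightarrow> int \<Rightarrow> real^2^2" where
  "schroedinger_cocycle E v j = vector [vector [E - v j, - 1], vector [1, 0]]"

lemma schroedinger_cocycle_SL2R: "schroedinger_cocycle E v j \<in> SL2R"
  by (simp add: SL2R_def schroedinger_cocycle_def det_2)

end

theory Submission imports Defs begin

text \<open>For real \<open>E\<close>, membership of \<open>E\<close> in the resolvent set and uniform hyperbolicity are both equivalent to a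
  convexity property of the orbits of the cocycle: for some \<open>N\<close>, every orbit \<open>x\<close> satisfies
  \<open>8 |x (j + N)|^2 \<le> |x j|^2 + |x (j + 2 N)|^2\<close>.

  \<^item> If \<open>H - E\<close> is bounded below, test it on a solution of \<open>H \<psi> = E \<psi>\<close> cut off to a window. The
    mass of \<open>\<psi>\<close> in the window is then controlled by the values of \<open>\<psi>\<close> at the two ends, and
    averaging over windows gives convexity.
  \<^item> Under convexity an orbit that is bounded in one direction decays exponentially in that direction.
    The initial values of such orbits form a line by compactness and \<open>det = 1\<close>; these are the
    lines \<open>u j\<close> and \<open>s j\<close>.
  \<^item> Under uniform hyperbolicity convexity follows by splitting \<open>x (j + N)\<close> along the two lines.
  \<^item> Convexity bounds \<open>H - E\<close> from below: for \<open>(H - E) \<psi> = f\<close> the vectors \<open>(\<psi> n, \<psi> (n - 1))\<close> form an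
    orbit up to an error controlled by \<open>f\<close>, and one sums the convexity inequality over \<open>n\<close>.

  Finally \<open>H - z\<close> is always bounded below for \<open>z\<close> not real, and being bounded below is equivalent to
  being invertible because \<open>H\<close> is symmetric.\<close>

subsection \<open>The space \<open>ell2\<close>\<close>

lemma ell2_norm_square: "(ell2_norm \<psi>)\<^sup>2 = (\<Sum>\<^sub>\<infinity>n. (cmod (\<psi> n))\<^sup>2)"
  by (simp add: ell2_norm_def infsum_nonneg)

lemma ell2_norm_nonneg: "0 \<le> ell2_norm \<psi>"
  by (simp add: ell2_norm_def infsum_nonneg)

lemma ell2_dominated:
  assumes "g summable_on UNIV" "\<And>n. (cmod (\<psi> n))\<^sup>2 \<le> g n"
  shows "\<psi> \<in> ell2" "(ell2_norm \<psi>)\<^sup>2 \<le> infsum g UNIV"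
proof -
  have s: "(\<lambda>n. (cmod (\<psi> n))\<^sup>2) summable_on UNIV"
    by (rule summable_on_comparison_test[OF assms(1)]) (auto simp: assms(2))
  then show "\<psi> \<in> ell2" by (simp add: ell2_def)
  show "(ell2_norm \<psi>)\<^sup>2 \<le> infsum g UNIV"
    unfolding ell2_norm_square by (rule infsum_mono[OF s assms(1)]) (rule assms(2))
qed

lemma ell2_summable: "\<psi> \<in> ell2 \<Longrightarrow> (\<lambda>n. (cmod (\<psi> n))\<^sup>2) summable_on UNIV"
  by (simp add: ell2_def)

lemma ell2_cmult:
  assumes "\<psi> \<in> ell2"
  shows "(\<lambda>n. c * \<psi> n) \<in> ell2" "(ell2_norm (\<lambda>n. c * \<psi> n))\<^sup>2 = (cmod c)\<^sup>2 * (ell2_norm \<psi>)\<^sup>2"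
  using ell2_summable[OF assms]
  by (auto simp: ell2_norm_square norm_mult power_mult_distrib infsum_cmult_right' ell2_def
      intro!: summable_on_cmult_right)

lemma cmod_square_add_le: "(cmod (a + b))\<^sup>2 \<le> 2 * (cmod a)\<^sup>2 + 2 * (cmod b)\<^sup>2"
proof -
  have "(cmod (a + b))\<^sup>2 \<le> (cmod a + cmod b)\<^sup>2"
    by (intro power_mono norm_triangle_ineq) simp
  moreover have "0 \<le> (cmod a - cmod b)\<^sup>2" by simp
  ultimately show ?thesis by (simp add: power2_eq_square algebra_simps)
qed

lemma ell2_add:
  assumes "\<psi> \<in> ell2" "\<phi> \<in> ell2"
  shows "(\<lambda>n. \<psi> n + \<phi> n) \<in> ell2"
    and "(ell2_norm (\<lambda>n. \<psi> n + \<phi> n))\<^sup>2 \<le> 2 * (ell2_norm \<psi>)\<^sup>2 + 2 * (ell2_norm \<phi>)\<^sup>2"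
proof -
  let ?g = "\<lambda>n. 2 * (cmod (\<psi> n))\<^sup>2 + 2 * (cmod (\<phi> n))\<^sup>2"
  note s = assms[THEN ell2_summable]
  have g: "?g summable_on UNIV"
    by (intro summable_on_add summable_on_cmult_right s)
  have "infsum ?g UNIV = 2 * (ell2_norm \<psi>)\<^sup>2 + 2 * (ell2_norm \<phi>)\<^sup>2"
    by (simp add: infsum_add summable_on_cmult_right s infsum_cmult_right' ell2_norm_square)
  with ell2_dominated[OF g, of "\<lambda>n. \<psi> n + \<phi> n"] cmod_square_add_le
  show "(\<lambda>n. \<psi> n + \<phi> n) \<in> ell2"
    "(ell2_norm (\<lambda>n. \<psi> n + \<phi> n))\<^sup>2 \<le> 2 * (ell2_norm \<psi>)\<^sup>2 + 2 * (ell2_norm \<phi>)\<^sup>2"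
    by auto
qed

lemma ell2_diff:
  assumes "\<psi> \<in> ell2" "\<phi> \<in> ell2"
  shows "(\<lambda>n. \<psi> n - \<phi> n) \<in> ell2"
    and "(ell2_norm (\<lambda>n. \<psi> n - \<phi> n))\<^sup>2 \<le> 2 * (ell2_norm \<psi>)\<^sup>2 + 2 * (ell2_norm \<phi>)\<^sup>2"
  using ell2_add[OF assms(1) ell2_cmult(1)[OF assms(2), of "-1"]] ell2_cmult(2)[OF assms(2), of "-1"]
  by simp_all

lemma ell2_sum:
  "(\<And>k. k \<in> F \<Longrightarrow> f k \<in> ell2) \<Longrightarrow> (\<lambda>n. \<Sum>k\<in>F. f k n) \<in> ell2"
proof (induction F rule: infinite_finite_induct)
  case (insert k F)
  then show ?case by (simp add: ell2_add(1))
qed (auto simp: ell2_def)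

lemma cmod_le_ell2_norm:
  assumes "\<psi> \<in> ell2"
  shows "cmod (\<psi> n) \<le> ell2_norm \<psi>"
proof -
  have "(\<Sum>k\<in>{n}. (cmod (\<psi> k))\<^sup>2) \<le> (\<Sum>\<^sub>\<infinity>k. (cmod (\<psi> k))\<^sup>2)"
    by (rule finite_sum_le_infsum[OF ell2_summable[OF assms]]) auto
  then have "(cmod (\<psi> n))\<^sup>2 \<le> (ell2_norm \<psi>)\<^sup>2"
    by (simp add: ell2_norm_square)
  then show ?thesis
    by (rule power2_le_imp_le) (rule ell2_norm_nonneg)
qed

lemma ell2_norm_zero_iff:
  assumes "\<psi> \<in> ell2" "ell2_norm \<psi> \<le> 0"
  shows "\<psi> = (\<lambda>n. 0)"
  using cmod_le_ell2_norm[OF assms(1)] assms(2) by (metis norm_le_zero_iff order_trans)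

text \<open>Fatou's argument: each finite partial sum of squares passes to the limit and keeps the
  bound \<open>B\<close>, so all partial sums of the limit are bounded.\<close>

lemma ell2_pointwise_limit:
  assumes lim: "\<And>n. (\<lambda>m. \<psi> m n) \<longlonglongrightarrow> \<psi>' n"
    and ell: "\<And>m. \<psi> m \<in> ell2" and le: "\<And>m. (ell2_norm (\<psi> m))\<^sup>2 \<le> B"
  shows "\<psi>' \<in> ell2"
proof -
  have "(\<Sum>n\<in>F. (cmod (\<psi>' n))\<^sup>2) \<le> B" if F: "finite F" for F
  proof (rule LIMSEQ_le_const2)
    show "(\<lambda>m. \<Sum>n\<in>F. (cmod (\<psi> m n))\<^sup>2) \<longlonglongrightarrow> (\<Sum>n\<in>F. (cmod (\<psi>' n))\<^sup>2)"
      by (intro tendsto_intros lim)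
    have "(\<Sum>n\<in>F. (cmod (\<psi> m n))\<^sup>2) \<le> (ell2_norm (\<psi> m))\<^sup>2" for m
      unfolding ell2_norm_square
      by (rule finite_sum_le_infsum[OF ell2_summable[OF ell]]) (auto simp: F)
    with le show "\<exists>M. \<forall>m\<ge>M. (\<Sum>n\<in>F. (cmod (\<psi> m n))\<^sup>2) \<le> B"
      using order_trans by blast
  qed
  then have "(\<lambda>n. (cmod (\<psi>' n))\<^sup>2) summable_on UNIV"
    by (intro nonneg_bounded_partial_sums_imp_summable_on[where C=B]) (auto intro!: eventually_finite_subsets_at_top_weakI)
  then show ?thesis by (simp add: ell2_def)
qed

subsection \<open>The inner product\<close>

definition ell2_inner :: "(int \<Rightarrow> complex) \<Rightarrow> (int \<Rightarrow> complex) \<Rightarrow> complex" where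
  "ell2_inner \<phi> \<psi> = (\<Sum>\<^sub>\<infinity>n. cnj (\<phi> n) * \<psi> n)"

lemma ell2_inner_summable:
  assumes "\<phi> \<in> ell2" "\<psi> \<in> ell2"
  shows "(\<lambda>n. cnj (\<phi> n) * \<psi> n) summable_on UNIV"
proof (rule abs_summable_summable[OF Infinite_Sum.abs_summable_on_comparison_test'])
  show "(\<lambda>n. (cmod (\<phi> n))\<^sup>2 + (cmod (\<psi> n))\<^sup>2) summable_on UNIV"
    by (intro summable_on_add ell2_summable assms)
  fix n
  have "2 * (cmod (\<phi> n) * cmod (\<psi> n)) \<le> (cmod (\<phi> n))\<^sup>2 + (cmod (\<psi> n))\<^sup>2"
    using sum_squares_bound[of "cmod (\<phi> n)" "cmod (\<psi> n)"] by simp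
  moreover have "0 \<le> cmod (\<phi> n) * cmod (\<psi> n)" by simp
  ultimately have "cmod (\<phi> n) * cmod (\<psi> n) \<le> (cmod (\<phi> n))\<^sup>2 + (cmod (\<psi> n))\<^sup>2"
    by linarith
  then show "norm (cnj (\<phi> n) * \<psi> n) \<le> (cmod (\<phi> n))\<^sup>2 + (cmod (\<psi> n))\<^sup>2"
    by (simp add: norm_mult)
qed

lemma ell2_inner_self:
  assumes "\<psi> \<in> ell2" shows "ell2_inner \<psi> \<psi> = of_real ((ell2_norm \<psi>)\<^sup>2)"
proof -
  have *: "cnj (\<psi> n) * \<psi> n = of_real ((cmod (\<psi> n))\<^sup>2)" for n
    by (simp only: complex_norm_square mult.commute)
  have "((\<lambda>n. (cmod (\<psi> n))\<^sup>2) has_sum (ell2_norm \<psi>)\<^sup>2) UNIV"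
    unfolding ell2_norm_square using ell2_summable[OF assms] by (rule has_sum_infsum)
  then show ?thesis
    unfolding ell2_inner_def * by (intro infsumI has_sum_of_real)
qed

text \<open>Serves two purposes: the contraction estimate for \<open>1 - t S\<close>, and, with
  \<open>\<i> * \<psi>\<close> in place of \<open>\<psi>\<close>, the lower bound for nonreal
  \<open>z\<close>.\<close>

lemma ell2_norm_diff_square:
  fixes t :: real
  assumes "\<phi> \<in> ell2" "\<psi> \<in> ell2"
  shows "(ell2_norm (\<lambda>n. \<phi> n - of_real t * \<psi> n))\<^sup>2 =
    (ell2_norm \<phi>)\<^sup>2 - 2 * t * Re (ell2_inner \<phi> \<psi>) + t\<^sup>2 * (ell2_norm \<psi>)\<^sup>2"
proof -
  have *: "(cmod (\<phi> n - of_real t * \<psi> n))\<^sup>2 = (cmod (\<phi> n))\<^sup>2 + (- 2 * t) * Re (cnj (\<phi> n) * \<psi> n) + t\<^sup>2 * (cmod (\<psi> n))\<^sup>2" for n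
    by (simp add: cmod_power2) (simp add: power2_eq_square algebra_simps)
  have "((\<lambda>n. Re (cnj (\<phi> n) * \<psi> n)) has_sum Re (ell2_inner \<phi> \<psi>)) UNIV"
    unfolding ell2_inner_def
    by (intro has_sum_Re has_sum_infsum ell2_inner_summable assms)
  moreover have "((\<lambda>n. (cmod (\<phi> n))\<^sup>2) has_sum (ell2_norm \<phi>)\<^sup>2) UNIV"
    "((\<lambda>n. (cmod (\<psi> n))\<^sup>2) has_sum (ell2_norm \<psi>)\<^sup>2) UNIV"
    unfolding ell2_norm_square by (intro has_sum_infsum ell2_summable assms)+
  ultimately have "((\<lambda>n. (cmod (\<phi> n - of_real t * \<psi> n))\<^sup>2) has_sum
      (ell2_norm \<phi>)\<^sup>2 + (- 2 * t) * Re (ell2_inner \<phi> \<psi>) + t\<^sup>2 * (ell2_norm \<psi>)\<^sup>2) UNIV"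
    unfolding * by (intro has_sum_add has_sum_cmult_right)
  then show ?thesis
    unfolding ell2_norm_square[of "\<lambda>n. \<phi> n - of_real t * \<psi> n"] by (simp add: infsumI)
qed

text \<open>Translating the index set of all integers leaves the sum unchanged, so no boundary terms
  remain. This is the summation by parts behind the symmetry of \<open>H\<close>.\<close>

lemma has_sum_int_telescope:
  fixes f :: "int \<Rightarrow> complex"
  assumes "f summable_on UNIV"
  shows "((\<lambda>n. f n - f (n - 1)) has_sum 0) UNIV"
proof -
  have b: "bij_betw (\<lambda>n::int. n - 1) UNIV UNIV"
    by (rule bij_betwI[where g = "\<lambda>n. n + 1"]) auto
  have 1: "(f has_sum infsum f UNIV) UNIV"
    using assms by (rule has_sum_infsum)
  then have "((\<lambda>n. f (n - 1)) has_sum infsum f UNIV) UNIV"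
    using has_sum_reindex_bij_betw[OF b, of f] by simp
  from has_sum_add[OF 1 has_sum_uminusI[OF this]] show ?thesis by simp
qed

lemma ell2_translate: "\<psi> \<in> ell2 \<Longrightarrow> (\<lambda>n. \<psi> (n + k)) \<in> ell2"
  using ell2_shift(1)[of \<psi> k] by (simp add: ell2_def)

subsection \<open>The operator \<open>H - z\<close>\<close>

definition shifted_op :: "(int \<Rightarrow> real) \<Rightarrow> complex \<Rightarrow> (int \<Rightarrow> complex) \<Rightarrow> (int \<Rightarrow> complex)" where
  "shifted_op v z \<psi> = (\<lambda>n. schroedinger_op v \<psi> n - z * \<psi> n)"

definition bounded_below :: "((int \<Rightarrow> complex) \<Rightarrow> (int \<Rightarrow> complex)) \<Rightarrow> bool" where
  "bounded_below T \<longleftrightarrow> (\<exists>K>0. \<forall>\<psi>\<in>ell2. (ell2_norm \<psi>)\<^sup>2 \<le> K * (ell2_norm (T \<psi>))\<^sup>2)"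

lemma shifted_op_add: "shifted_op v z (\<lambda>n. \<phi> n + \<psi> n) = (\<lambda>n. shifted_op v z \<phi> n + shifted_op v z \<psi> n)"
  and shifted_op_diff: "shifted_op v z (\<lambda>n. \<phi> n - \<psi> n) = (\<lambda>n. shifted_op v z \<phi> n - shifted_op v z \<psi> n)"
  and shifted_op_cmult: "shifted_op v z (\<lambda>n. c * \<psi> n) = (\<lambda>n. c * shifted_op v z \<psi> n)"
  by (auto simp: shifted_op_def schroedinger_op_def fun_eq_iff algebra_simps)

lemma shifted_op_bounded:
  assumes "bounded (range v)"
  obtains K where "K > 0"
    "\<And>\<psi>. \<psi> \<in> ell2 \<Longrightarrow> shifted_op v z \<psi> \<in> ell2 \<and> (ell2_norm (shifted_op v z \<psi>))\<^sup>2 \<le> K * (ell2_norm \<psi>)\<^sup>2"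
proof -
  obtain C where C: "\<And>\<psi>. \<psi> \<in> ell2 \<Longrightarrow> schroedinger_op v \<psi> \<in> ell2 \<and> ell2_norm (schroedinger_op v \<psi>) \<le> C * ell2_norm \<psi>"
    using bounded_schroedinger_op[OF assms] unfolding bounded_ell2_operator_def by blast
  show ?thesis
  proof (rule that[of "2 * C\<^sup>2 + 2 * (cmod z)\<^sup>2 + 1"])
    show "0 < 2 * C\<^sup>2 + 2 * (cmod z)\<^sup>2 + 1" by (simp add: add_nonneg_pos)
    fix \<psi> assume p: "\<psi> \<in> ell2"
    have 1: "(ell2_norm (schroedinger_op v \<psi>))\<^sup>2 \<le> (C * ell2_norm \<psi>)\<^sup>2"
      using C[OF p] ell2_norm_nonneg by (intro power_mono) auto
    note d = ell2_diff[OF conjunct1[OF C[OF p]] ell2_cmult(1)[OF p, of z]]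
    have "(ell2_norm (shifted_op v z \<psi>))\<^sup>2 \<le> 2 * (C * ell2_norm \<psi>)\<^sup>2 + 2 * ((cmod z)\<^sup>2 * (ell2_norm \<psi>)\<^sup>2)"
      using d(2) 1 unfolding shifted_op_def ell2_cmult(2)[OF p] by linarith
    also have "\<dots> \<le> (2 * C\<^sup>2 + 2 * (cmod z)\<^sup>2 + 1) * (ell2_norm \<psi>)\<^sup>2"
      by (simp add: algebra_simps power_mult_distrib)
    finally show "shifted_op v z \<psi> \<in> ell2 \<and> (ell2_norm (shifted_op v z \<psi>))\<^sup>2 \<le> (2 * C\<^sup>2 + 2 * (cmod z)\<^sup>2 + 1) * (ell2_norm \<psi>)\<^sup>2"
      using d(1) by (simp add: shifted_op_def)
  qed
qed

lemma shifted_op_ell2: "bounded (range v) \<Longrightarrow> \<psi> \<in> ell2 \<Longrightarrow> shifted_op v z \<psi> \<in> ell2"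
  using shifted_op_bounded by metis

lemma shifted_op_adjoint:
  assumes v: "bounded (range v)" and ell: "\<phi> \<in> ell2" "\<psi> \<in> ell2"
  shows "ell2_inner \<phi> (shifted_op v z \<psi>) = ell2_inner (shifted_op v (cnj z) \<phi>) \<psi>"
proof -
  define a where "a n = cnj (\<phi> n) * \<psi> (n + 1)" for n
  define b where "b n = cnj (\<phi> (n + 1)) * \<psi> n" for n
  have ab: "a summable_on UNIV" "b summable_on UNIV"
    unfolding a_def b_def by (intro ell2_inner_summable ell2_translate ell)+
  \<comment> \<open>The diagonal terms agree because \<open>v\<close> is real and \<open>z\<close>
    is conjugated twice. The four shift terms are \<open>a n\<close>, \<open>b (n - 1)\<close> on
    the left and \<open>b n\<close>, \<open>a (n - 1)\<close> on the right, so they pair into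
    telescoping differences.\<close>
  have *: "cnj (\<phi> n) * shifted_op v z \<psi> n =
      cnj (shifted_op v (cnj z) \<phi> n) * \<psi> n + ((a n - a (n - 1)) + - (b n - b (n - 1)))" for n
    by (simp add: shifted_op_def schroedinger_op_def a_def b_def algebra_simps)
  have "((\<lambda>n. cnj (shifted_op v (cnj z) \<phi> n) * \<psi> n) has_sum ell2_inner (shifted_op v (cnj z) \<phi>) \<psi>) UNIV"
    unfolding ell2_inner_def
    by (intro has_sum_infsum ell2_inner_summable shifted_op_ell2 v ell)
  moreover have "((\<lambda>n. (a n - a (n - 1)) + - (b n - b (n - 1))) has_sum 0 + - 0) UNIV"
    by (intro has_sum_add has_sum_uminusI has_sum_int_telescope ab)
  ultimately have "((\<lambda>n. cnj (\<phi> n) * shifted_op v z \<psi> n) has_sum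
      ell2_inner (shifted_op v (cnj z) \<phi>) \<psi> + (0 + - 0)) UNIV"
    unfolding * by (rule has_sum_add)
  then show ?thesis
    by (simp add: ell2_inner_def[of \<phi>] infsumI)
qed

section \<open>Lower bounds and invertibility of H - z\<close>

lemma resolvent_imp_bounded_below:
  assumes R: "bounded_ell2_operator R" "\<And>\<psi>. \<psi> \<in> ell2 \<Longrightarrow> R (T \<psi>) = \<psi>"
    and T: "\<And>\<psi>. \<psi> \<in> ell2 \<Longrightarrow> T \<psi> \<in> ell2"
  shows "bounded_below T"
proof -
  obtain K where K: "\<And>\<psi>. \<psi> \<in> ell2 \<Longrightarrow> ell2_norm (R \<psi>) \<le> K * ell2_norm \<psi>"
    using R(1) unfolding bounded_ell2_operator_def by blast
  have "(ell2_norm \<psi>)\<^sup>2 \<le> (K\<^sup>2 + 1) * (ell2_norm (T \<psi>))\<^sup>2" if p: "\<psi> \<in> ell2" for \<psi>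
  proof -
    have "(ell2_norm \<psi>)\<^sup>2 \<le> (K * ell2_norm (T \<psi>))\<^sup>2"
      using K[OF T[OF p]] R(2)[OF p] ell2_norm_nonneg by (intro power_mono) auto
    then show ?thesis by (simp add: algebra_simps power_mult_distrib add_increasing)
  qed
  moreover have "0 < K\<^sup>2 + 1" by (simp add: add_nonneg_pos)
  ultimately show ?thesis unfolding bounded_below_def by blast
qed

text \<open>For symmetric \<open>T = H - Re z\<close> the number \<open><T \<psi>, \<psi>>\<close>
  is real, so the cross term in \<open>|T \<psi> - i s \<psi>|^2\<close> vanishes and
  \<open>s^2 |\<psi>|^2\<close> is left as a lower bound, where \<open>s = Im z\<close>.\<close>

lemma nonreal_bounded_below:
  assumes v: "bounded (range v)" and z: "Im z \<noteq> 0"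
  shows "bounded_below (shifted_op v z)"
proof -
  define T where "T = shifted_op v (of_real (Re z))"
  define s where "s = Im z"
  have "(ell2_norm \<psi>)\<^sup>2 \<le> 1 / s\<^sup>2 * (ell2_norm (shifted_op v z \<psi>))\<^sup>2" if p: "\<psi> \<in> ell2" for \<psi>
  proof -
    have T: "T \<psi> \<in> ell2" unfolding T_def by (rule shifted_op_ell2[OF v p])
    have ip: "(\<lambda>n. \<i> * \<psi> n) \<in> ell2" "(ell2_norm (\<lambda>n. \<i> * \<psi> n))\<^sup>2 = (ell2_norm \<psi>)\<^sup>2"
      using ell2_cmult[OF p, of \<i>] by simp_all
    have "ell2_inner \<psi> (T \<psi>) = ell2_inner (T \<psi>) \<psi>"
      unfolding T_def using shifted_op_adjoint[OF v p p, of "of_real (Re z)"] by simp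
    moreover have "ell2_inner (T \<psi>) \<psi> = cnj (ell2_inner \<psi> (T \<psi>))"
      unfolding ell2_inner_def infsum_cnj[symmetric] by (simp add: mult.commute)
    ultimately have "Im (ell2_inner (T \<psi>) \<psi>) = 0"
      by (simp add: complex_eq_iff)
    moreover have "ell2_inner (T \<psi>) (\<lambda>n. \<i> * \<psi> n) = \<i> * ell2_inner (T \<psi>) \<psi>"
      unfolding ell2_inner_def infsum_cmult_right'[symmetric] by (simp add: mult.left_commute)
    ultimately have *: "Re (ell2_inner (T \<psi>) (\<lambda>n. \<i> * \<psi> n)) = 0" by simp
    have "shifted_op v z \<psi> = (\<lambda>n. T \<psi> n - of_real s * (\<i> * \<psi> n))"
      unfolding shifted_op_def T_def s_def
      by (subst complex_eq) (simp add: fun_eq_iff algebra_simps)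
    then have "(ell2_norm (shifted_op v z \<psi>))\<^sup>2 = (ell2_norm (T \<psi>))\<^sup>2 + s\<^sup>2 * (ell2_norm \<psi>)\<^sup>2"
      using ell2_norm_diff_square[OF T ip(1), of s] * ip(2) by simp
    then have "s\<^sup>2 * (ell2_norm \<psi>)\<^sup>2 \<le> (ell2_norm (shifted_op v z \<psi>))\<^sup>2" by simp
    then show ?thesis using z by (simp add: s_def field_simps)
  qed
  then show ?thesis
    unfolding bounded_below_def using z by (intro exI[of _ "1 / s\<^sup>2"]) (simp add: s_def)
qed

lemma shifted_op_pointwise_limit:
  assumes "\<And>n. (\<lambda>m. \<xi> m n) \<longlonglongrightarrow> \<xi>' n"
  shows "(\<lambda>m. shifted_op v z (\<xi> m) n) \<longlonglongrightarrow> shifted_op v z \<xi>' n"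
  unfolding shifted_op_def schroedinger_op_def by (intro tendsto_intros assms)

text \<open>Lax--Milgram for the coercive operator \<open>S = (H - z) (H - cnj z)\<close>: for small \<open>t > 0\<close> the map
  \<open>1 - t S\<close> is a contraction, and the Neumann series for \<open>S\<close> is summed pointwise, because
  \<open>ell2\<close> is not available as a Banach space type.\<close>

lemma bounded_below_imp_surj:
  assumes v: "bounded (range v)"
    and bb: "bounded_below (shifted_op v z)" "bounded_below (shifted_op v (cnj z))"
    and \<phi>: "\<phi> \<in> ell2"
  obtains \<psi> where "\<psi> \<in> ell2" "shifted_op v z \<psi> = \<phi>"
proof -
  define S where "S \<xi> = shifted_op v z (shifted_op v (cnj z) \<xi>)" for \<xi>
  obtain K1 where K1: "K1 > 0" "\<And>\<psi>. \<psi> \<in> ell2 \<Longrightarrow> (ell2_norm \<psi>)\<^sup>2 \<le> K1 * (ell2_norm (shifted_op v z \<psi>))\<^sup>2"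
    using bb(1) unfolding bounded_below_def by blast
  obtain K2 where K2: "K2 > 0" "\<And>\<psi>. \<psi> \<in> ell2 \<Longrightarrow> (ell2_norm \<psi>)\<^sup>2 \<le> K2 * (ell2_norm (shifted_op v (cnj z) \<psi>))\<^sup>2"
    using bb(2) unfolding bounded_below_def by blast
  obtain M1 where M1: "M1 > 0"
      "\<And>\<psi>. \<psi> \<in> ell2 \<Longrightarrow> shifted_op v z \<psi> \<in> ell2 \<and> (ell2_norm (shifted_op v z \<psi>))\<^sup>2 \<le> M1 * (ell2_norm \<psi>)\<^sup>2"
    using shifted_op_bounded[OF v, of z] by blast
  obtain M2 where M2: "M2 > 0"
      "\<And>\<psi>. \<psi> \<in> ell2 \<Longrightarrow> shifted_op v (cnj z) \<psi> \<in> ell2 \<and> (ell2_norm (shifted_op v (cnj z) \<psi>))\<^sup>2 \<le> M2 * (ell2_norm \<psi>)\<^sup>2"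
    using shifted_op_bounded[OF v, of "cnj z"] by blast
  note T = conjunct1[OF M1(2)] conjunct1[OF M2(2)]
  define M where "M = M1 * M2"
  have M: "M > 0" using M1 M2 by (simp add: M_def)
  have S_ell2: "S \<xi> \<in> ell2" and S_le: "(ell2_norm (S \<xi>))\<^sup>2 \<le> M * (ell2_norm \<xi>)\<^sup>2"
    and S_ge: "(ell2_norm \<xi>)\<^sup>2 \<le> K2 * K1 * (ell2_norm (S \<xi>))\<^sup>2"
    and S_inner: "Re (ell2_inner \<xi> (S \<xi>)) \<ge> (ell2_norm \<xi>)\<^sup>2 / K2" if "\<xi> \<in> ell2" for \<xi>
  proof -
    show "S \<xi> \<in> ell2" unfolding S_def by (intro T that)
    have "(ell2_norm (S \<xi>))\<^sup>2 \<le> M1 * (ell2_norm (shifted_op v (cnj z) \<xi>))\<^sup>2"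
      unfolding S_def using M1(2)[OF T(2)[OF that]] by simp
    also have "\<dots> \<le> M1 * (M2 * (ell2_norm \<xi>)\<^sup>2)"
      using M1(1) M2(2)[OF that] by (intro mult_left_mono) auto
    finally show "(ell2_norm (S \<xi>))\<^sup>2 \<le> M * (ell2_norm \<xi>)\<^sup>2" by (simp add: M_def)
    have "(ell2_norm \<xi>)\<^sup>2 \<le> K2 * (ell2_norm (shifted_op v (cnj z) \<xi>))\<^sup>2"
      by (rule K2(2)[OF that])
    also have "\<dots> \<le> K2 * (K1 * (ell2_norm (S \<xi>))\<^sup>2)"
      unfolding S_def using K2(1) K1(2)[OF T(2)[OF that]] by (intro mult_left_mono) auto
    finally show "(ell2_norm \<xi>)\<^sup>2 \<le> K2 * K1 * (ell2_norm (S \<xi>))\<^sup>2" by simp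
    have "ell2_inner \<xi> (S \<xi>) = of_real ((ell2_norm (shifted_op v (cnj z) \<xi>))\<^sup>2)"
      unfolding S_def shifted_op_adjoint[OF v that T(2)[OF that]]
      by (rule ell2_inner_self[OF T(2)[OF that]])
    then show "Re (ell2_inner \<xi> (S \<xi>)) \<ge> (ell2_norm \<xi>)\<^sup>2 / K2"
      using K2(1) K2(2)[OF that] by (simp add: field_simps)
  qed
  \<comment> \<open>This \<open>t\<close> minimises \<open>1 - 2 t / K2 + t^2 M\<close>, the factor
    obtained from coercivity \<open>1 / K2\<close> and the bound \<open>M\<close> on
    \<open>S\<close>; the minimum is \<open>1 - 1 / (K2^2 M)\<close>.\<close>
  define t where "t = 1 / (K2 * M)"
  have t: "t > 0" using K2 M by (simp add: t_def)
  define L where "L \<xi> = (\<lambda>n. \<xi> n - of_real t * S \<xi> n)" for \<xi>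
  \<comment> \<open>The maximum with 0 makes \<open>sqrt r\<close> usable as the ratio of a
    geometric series.\<close>
  define r where "r = max (1 - 1 / (K2\<^sup>2 * M)) 0"
  have r: "0 \<le> r" "r < 1" using K2 M by (auto simp: r_def)
  have L_ell2: "L \<xi> \<in> ell2" and L_le: "(ell2_norm (L \<xi>))\<^sup>2 \<le> r * (ell2_norm \<xi>)\<^sup>2" if c: "\<xi> \<in> ell2" for \<xi>
  proof -
    show "L \<xi> \<in> ell2" unfolding L_def by (intro ell2_diff ell2_cmult c S_ell2)
    have "(ell2_norm (L \<xi>))\<^sup>2 = (ell2_norm \<xi>)\<^sup>2 - 2 * t * Re (ell2_inner \<xi> (S \<xi>)) + t\<^sup>2 * (ell2_norm (S \<xi>))\<^sup>2"
      unfolding L_def by (rule ell2_norm_diff_square[OF c S_ell2[OF c]])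
    also have "\<dots> \<le> (ell2_norm \<xi>)\<^sup>2 - 2 * t * ((ell2_norm \<xi>)\<^sup>2 / K2) + t\<^sup>2 * (M * (ell2_norm \<xi>)\<^sup>2)"
      using S_inner[OF c] S_le[OF c] t by (intro add_mono diff_mono mult_left_mono) auto
    also have "\<dots> = (1 - 1 / (K2\<^sup>2 * M)) * (ell2_norm \<xi>)\<^sup>2"
      using K2(1) M by (simp add: t_def field_simps power2_eq_square)
    also have "\<dots> \<le> r * (ell2_norm \<xi>)\<^sup>2"
      by (intro mult_right_mono) (auto simp: r_def)
    finally show "(ell2_norm (L \<xi>))\<^sup>2 \<le> r * (ell2_norm \<xi>)\<^sup>2" .
  qed
  define f where "f k = (L ^^ k) \<phi>" for k
  have f: "f k \<in> ell2" "(ell2_norm (f k))\<^sup>2 \<le> r ^ k * (ell2_norm \<phi>)\<^sup>2" for k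
  proof (induction k)
    case (Suc k)
    show "f (Suc k) \<in> ell2" using L_ell2[OF Suc(1)] by (simp add: f_def)
    show "(ell2_norm (f (Suc k)))\<^sup>2 \<le> r ^ Suc k * (ell2_norm \<phi>)\<^sup>2"
      using L_le[OF Suc(1)] mult_left_mono[OF Suc(2) r(1)] by (simp add: f_def mult.assoc)
  qed (simp_all add: f_def \<phi>)
  have f_le: "ell2_norm (f k) \<le> sqrt r ^ k * ell2_norm \<phi>" for k
    using real_sqrt_le_mono[OF f(2)[of k]] ell2_norm_nonneg
    by (simp add: real_sqrt_mult real_sqrt_power)
  have sm: "summable (\<lambda>k. f k n)" for n
  proof (rule summable_comparison_test')
    show "summable (\<lambda>k. sqrt r ^ k * ell2_norm \<phi>)"
      using r by (intro summable_mult2 summable_geometric) (auto simp: real_sqrt_lt_1_iff)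
    show "norm (f k n) \<le> sqrt r ^ k * ell2_norm \<phi>" for k
      using cmod_le_ell2_norm[OF f(1)] f_le order_trans by blast
  qed
  define \<xi> where "\<xi> m n = (\<Sum>k<m. f k n)" for m n
  define \<xi>' where "\<xi>' n = (\<Sum>k. f k n)" for n
  have lim: "(\<lambda>m. \<xi> m n) \<longlonglongrightarrow> \<xi>' n" for n
    unfolding \<xi>_def \<xi>'_def by (rule summable_LIMSEQ[OF sm])
  have \<xi>: "\<xi> m \<in> ell2" for m
    unfolding \<xi>_def[abs_def] by (intro ell2_sum f)
  \<comment> \<open>Since \<open>t S = 1 - L\<close>, applying it to the partial sum of the powers
    of \<open>L\<close> telescopes.\<close>
  have tS: "of_real t * S (\<xi> m) n = \<phi> n - f m n" for m n
  proof (induction m)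
    case 0
    then show ?case by (simp add: f_def \<xi>_def S_def shifted_op_def schroedinger_op_def)
  next
    case (Suc m)
    have "\<xi> (Suc m) = (\<lambda>n. \<xi> m n + f m n)" by (simp add: \<xi>_def fun_eq_iff)
    then have "S (\<xi> (Suc m)) n = S (\<xi> m) n + S (f m) n"
      by (simp add: S_def shifted_op_add)
    moreover have "f (Suc m) n = f m n - of_real t * S (f m) n"
      by (simp add: f_def L_def)
    ultimately show ?case using Suc by (simp add: distrib_left)
  qed
  \<comment> \<open>The lower bound for \<open>S\<close> turns the bound on
    \<open>t S (\<xi> m) = \<phi> - f m\<close> into one on \<open>\<xi> m\<close> that is uniform
    in \<open>m\<close>, as the pointwise limit requires.\<close>
  have bd: "(ell2_norm (\<xi> m))\<^sup>2 \<le> K2 * K1 * (4 * (ell2_norm \<phi>)\<^sup>2 / t\<^sup>2)" for m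
  proof -
    have "t\<^sup>2 * (ell2_norm (S (\<xi> m)))\<^sup>2 = (ell2_norm (\<lambda>n. \<phi> n - f m n))\<^sup>2"
      using ell2_cmult(2)[OF S_ell2[OF \<xi>], of "of_real t"] by (simp add: tS)
    also have "\<dots> \<le> 2 * (ell2_norm \<phi>)\<^sup>2 + 2 * (ell2_norm (f m))\<^sup>2"
      by (rule ell2_diff[OF \<phi> f(1)])
    also have "(ell2_norm (f m))\<^sup>2 \<le> 1 * (ell2_norm \<phi>)\<^sup>2"
      using r by (intro order_trans[OF f(2)] mult_right_mono power_le_one) auto
    finally have "(ell2_norm (S (\<xi> m)))\<^sup>2 \<le> 4 * (ell2_norm \<phi>)\<^sup>2 / t\<^sup>2"
      using t by (simp add: field_simps)
    then have "K2 * K1 * (ell2_norm (S (\<xi> m)))\<^sup>2 \<le> K2 * K1 * (4 * (ell2_norm \<phi>)\<^sup>2 / t\<^sup>2)"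
      using K1 K2 by (intro mult_left_mono) auto
    with S_ge[OF \<xi>] show ?thesis by (rule order_trans)
  qed
  have \<xi>': "\<xi>' \<in> ell2"
    by (rule ell2_pointwise_limit[OF lim \<xi> bd])
  have "of_real t * S \<xi>' n = \<phi> n" for n
  proof (rule LIMSEQ_unique)
    show "(\<lambda>m. of_real t * S (\<xi> m) n) \<longlonglongrightarrow> of_real t * S \<xi>' n"
      unfolding S_def by (intro tendsto_intros shifted_op_pointwise_limit lim)
    show "(\<lambda>m. of_real t * S (\<xi> m) n) \<longlonglongrightarrow> \<phi> n"
      unfolding tS using tendsto_diff[OF tendsto_const summable_LIMSEQ_zero[OF sm]] by simp
  qed
  \<comment> \<open>Solving \<open>t S \<xi>' = \<phi>\<close> gives the preimage
    \<open>t (H - cnj z) \<xi>'\<close> under \<open>H - z\<close>.\<close>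
  then have "shifted_op v z (\<lambda>n. of_real t * shifted_op v (cnj z) \<xi>' n) = \<phi>"
    by (simp add: shifted_op_cmult S_def)
  moreover have "(\<lambda>n. of_real t * shifted_op v (cnj z) \<xi>' n) \<in> ell2"
    by (intro ell2_cmult T \<xi>')
  ultimately show ?thesis using that by blast
qed

text \<open>A lower bound for \<open>H - z\<close> gives injectivity and a bounded inverse on the
  range. Surjectivity also uses a lower bound for the adjoint \<open>H - cnj z\<close>, which the
  second assumption supplies.\<close>

lemma spectrum_iff_not_bounded_below:
  assumes v: "bounded (range v)"
    and cnj: "bounded_below (shifted_op v z) \<Longrightarrow> bounded_below (shifted_op v (cnj z))"
  shows "z \<in> ell2_spectrum (schroedinger_op v) \<longleftrightarrow> \<not> bounded_below (shifted_op v z)"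
proof -
  let ?T = "shifted_op v z"
  let ?res = "\<lambda>R. bounded_ell2_operator R \<and> (\<forall>\<psi>\<in>ell2. R (?T \<psi>) = \<psi>) \<and> (\<forall>\<psi>\<in>ell2. ?T (R \<psi>) = \<psi>)"
  have "bounded_below ?T" if "?res R" for R
    using resolvent_imp_bounded_below[of R ?T] shifted_op_ell2[OF v] that by blast
  moreover have "\<exists>R. ?res R" if bb: "bounded_below ?T"
  proof -
    obtain K where K: "K > 0" "\<And>\<psi>. \<psi> \<in> ell2 \<Longrightarrow> (ell2_norm \<psi>)\<^sup>2 \<le> K * (ell2_norm (?T \<psi>))\<^sup>2"
      using bb unfolding bounded_below_def by blast
    have inj: "\<phi> = \<psi>" if "\<phi> \<in> ell2" "\<psi> \<in> ell2" "?T \<phi> = ?T \<psi>" for \<phi> \<psi>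
    proof -
      have "?T (\<lambda>n. \<phi> n - \<psi> n) = (\<lambda>n. 0)" by (simp add: shifted_op_diff that)
      then have "(ell2_norm (\<lambda>n. \<phi> n - \<psi> n))\<^sup>2 \<le> 0"
        using K(2)[OF ell2_diff(1)[OF that(1,2)]] by (simp add: ell2_norm_def)
      then have "(\<lambda>n. \<phi> n - \<psi> n) = (\<lambda>n. 0)"
        by (intro ell2_norm_zero_iff ell2_diff that) simp
      then show ?thesis by (simp add: fun_eq_iff)
    qed
    have "\<exists>\<psi>. \<psi> \<in> ell2 \<and> ?T \<psi> = \<phi>" if "\<phi> \<in> ell2" for \<phi>
      by (rule bounded_below_imp_surj[OF v bb cnj[OF bb] that]) blast
    then have "\<forall>\<phi>\<in>ell2. \<exists>\<psi>. \<psi> \<in> ell2 \<and> ?T \<psi> = \<phi>" by (rule ballI)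
    from bchoice[OF this] obtain R
      where "\<forall>\<phi>\<in>ell2. R \<phi> \<in> ell2 \<and> ?T (R \<phi>) = \<phi>" by (rule exE)
    then have R: "\<And>\<phi>. \<phi> \<in> ell2 \<Longrightarrow> R \<phi> \<in> ell2" "\<And>\<phi>. \<phi> \<in> ell2 \<Longrightarrow> ?T (R \<phi>) = \<phi>"
      by simp_all
    \<comment> \<open>The inverse law and linearity of \<open>R\<close> each follow by applying
      \<open>?T\<close> to both sides and cancelling it with \<open>inj\<close>.\<close>
    have "R (?T \<psi>) = \<psi>" if "\<psi> \<in> ell2" for \<psi>
      by (rule inj) (simp_all add: R shifted_op_ell2 v that)
    moreover have "R (\<lambda>n. \<phi> n + \<psi> n) = (\<lambda>n. R \<phi> n + R \<psi> n)" if "\<phi> \<in> ell2" "\<psi> \<in> ell2" for \<phi> \<psi>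
      by (rule inj) (simp_all add: shifted_op_add R ell2_add that)
    moreover have "R (\<lambda>n. c * \<psi> n) = (\<lambda>n. c * R \<psi> n)" if "\<psi> \<in> ell2" for c \<psi>
      by (rule inj) (simp_all add: shifted_op_cmult R ell2_cmult that)
    moreover have "ell2_norm (R \<psi>) \<le> sqrt K * ell2_norm \<psi>" if "\<psi> \<in> ell2" for \<psi>
      using real_sqrt_le_mono[OF K(2)[OF R(1)[OF that]]] R(2)[OF that] ell2_norm_nonneg
      by (simp add: real_sqrt_mult)
    ultimately have "?res R"
      unfolding bounded_ell2_operator_def
      by (intro conjI ballI allI exI[of _ "sqrt K"]) (simp_all add: R)
    then show ?thesis by (intro exI[of _ R])
  qed
  ultimately have "(\<exists>R. ?res R) \<longleftrightarrow> bounded_below ?T" by iprover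
  then show ?thesis
    unfolding ell2_spectrum_def mem_Collect_eq by (simp only: shifted_op_def)
qed

subsection \<open>Iterates of a cocycle\<close>

lemma norm_square_vec2: "(norm (x::real^2))\<^sup>2 = (x $ 1)\<^sup>2 + (x $ 2)\<^sup>2"
  by (simp add: norm_vec_def L2_set_def sum_2)

lemma norm_square_add_le:
  fixes x y :: "'a::real_inner"
  shows "(norm (x + y))\<^sup>2 \<le> 2 * (norm x)\<^sup>2 + 2 * (norm y)\<^sup>2"
proof -
  have "0 \<le> (norm (x - y))\<^sup>2" by simp
  then show ?thesis by (simp add: power2_norm_eq_inner algebra_simps inner_commute)
qed

lemma matrix_inv_mult:
  fixes B :: "real^2^2"
  assumes "det B = 1"
  shows "B ** matrix_inv B = mat 1" "matrix_inv B ** B = mat 1"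
proof -
  have "invertible B" using assms by (simp add: invertible_det_nz)
  then have "\<exists>B'. B ** B' = mat 1 \<and> B' ** B = mat 1" by (simp add: invertible_def)
  from someI_ex[OF this] show "B ** matrix_inv B = mat 1" "matrix_inv B ** B = mat 1"
    unfolding matrix_inv_def by simp_all
qed

lemma forward_iterate_add:
  "forward_iterate A (n + m) j = forward_iterate A m (j + int n) ** forward_iterate A n j"
  by (induction m) (simp_all add: matrix_mul_assoc algebra_simps)

lemma forward_iterate_Suc2: "forward_iterate A (Suc n) j = forward_iterate A n (j + 1) ** A j"
  using forward_iterate_add[of A 1 n j] by simp

lemma backward_iterate_add:
  "backward_iterate A (n + m) j = backward_iterate A m (j - int n) ** backward_iterate A n j"
  by (induction m) (simp_all add: matrix_mul_assoc algebra_simps)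

lemma backward_iterate_Suc2:
  "backward_iterate A (Suc n) j = backward_iterate A n (j - 1) ** matrix_inv (A (j - 1))"
  using backward_iterate_add[of A 1 n j] by simp

lemma backward_forward_iterate:
  assumes "\<And>j. det (A j) = 1"
  shows "backward_iterate A n (j + int n) ** forward_iterate A n j = mat 1"
proof (induction n)
  case (Suc n)
  have "backward_iterate A (Suc n) (j + int (Suc n)) ** forward_iterate A (Suc n) j
    = backward_iterate A n (j + int n) ** (matrix_inv (A (j + int n)) ** A (j + int n)) ** forward_iterate A n j"
    by (simp only: backward_iterate_Suc2 forward_iterate.simps matrix_mul_assoc) (simp add: algebra_simps)
  then show ?case using Suc by (simp add: matrix_inv_mult assms)
qed simp

lemma forward_backward_iterate:
  assumes "\<And>j. det (A j) = 1"
  shows "forward_iterate A n (j - int n) ** backward_iterate A n j = mat 1"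
proof (induction n)
  case (Suc n)
  have "forward_iterate A (Suc n) (j - int (Suc n)) ** backward_iterate A (Suc n) j
    = forward_iterate A n (j - int n) ** (A (j - int (Suc n)) ** matrix_inv (A (j - int (Suc n)))) ** backward_iterate A n j"
    by (simp only: forward_iterate_Suc2 backward_iterate.simps matrix_mul_assoc) (simp add: algebra_simps)
  then show ?case using Suc by (simp add: matrix_inv_mult assms)
qed simp

lemma det_forward_iterate: "(\<And>j. det (A j) = 1) \<Longrightarrow> det (forward_iterate A n j) = 1"
  by (induction n) (simp_all add: det_mul)

lemma det_backward_iterate:
  assumes "\<And>j. det (A j) = 1" shows "det (backward_iterate A n j) = 1"
  using arg_cong[OF forward_backward_iterate[of A n j, OF assms], of det] det_forward_iterate[of A, OF assms]
  by (simp add: det_mul)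

text \<open>The inequality is symmetric in its two ends, so it serves both time directions. The
  constant 8 leaves room for a perturbation: when orbits are replaced by approximate orbits, the 8
  drops to 4 and the weights on the right become 1 and 2, whose sum is still below 4.\<close>

definition orbit_convex :: "(int \<Rightarrow> real^2^2) \<Rightarrow> nat \<Rightarrow> bool" where
  "orbit_convex A N \<longleftrightarrow> N \<ge> 1 \<and> (\<forall>j x. 8 * (norm (forward_iterate A N j *v x))\<^sup>2
     \<le> (norm x)\<^sup>2 + (norm (forward_iterate A (2 * N) j *v x))\<^sup>2)"

subsection \<open>Schroedinger cocycles\<close>

lemma schroedinger_cocycle_mult:
  "(schroedinger_cocycle E v j *v x) $ 1 = (E - v j) * x $ 1 - x $ 2"
  "(schroedinger_cocycle E v j *v x) $ 2 = x $ 1"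
  by (simp_all add: schroedinger_cocycle_def matrix_vector_mult_def sum_2)

lemma det_schroedinger_cocycle: "det (schroedinger_cocycle E v j) = 1"
  using schroedinger_cocycle_SL2R by (simp add: SL2R_def)

text \<open>The inverse matrix has the same form with the two coordinates exchanged, so one scalar
  estimate covers both.\<close>

lemma schroedinger_cocycle_bounded:
  assumes "bounded (range v)"
  obtains M where "M \<ge> 1" "\<And>j x. (norm (schroedinger_cocycle E v j *v x))\<^sup>2 \<le> M * (norm x)\<^sup>2"
    "\<And>j x. (norm (matrix_inv (schroedinger_cocycle E v j) *v x))\<^sup>2 \<le> M * (norm x)\<^sup>2"
proof -
  obtain B where B: "\<And>n. \<bar>v n\<bar> \<le> B"
    using assms unfolding bounded_iff by auto
  define c where "c = (\<bar>E\<bar> + B)\<^sup>2"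
  have c: "(E - v j)\<^sup>2 \<le> c" for j
    unfolding c_def using B[of j] abs_le_square_iff[of "E - v j" "\<bar>E\<bar> + B"] by auto
  have sq: "(a - b)\<^sup>2 \<le> 2 * a\<^sup>2 + 2 * b\<^sup>2" for a b :: real
  proof -
    have "0 \<le> (a + b)\<^sup>2" by simp
    then show ?thesis by (simp add: power2_eq_square algebra_simps)
  qed
  have *: "((E - v j) * a - b)\<^sup>2 + a\<^sup>2 \<le> (2 * c + 2) * (a\<^sup>2 + b\<^sup>2)" for j a b
  proof -
    have "((E - v j) * a - b)\<^sup>2 \<le> 2 * (c * a\<^sup>2) + 2 * b\<^sup>2"
      using sq[of "(E - v j) * a" b] mult_right_mono[OF c[of j], of "a\<^sup>2"] by (simp add: power_mult_distrib)
    moreover have "0 \<le> c * b\<^sup>2" by (simp add: c_def)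
    moreover have "0 \<le> a\<^sup>2" by simp
    moreover have "(2 * c + 2) * (a\<^sup>2 + b\<^sup>2) = 2 * (c * a\<^sup>2) + 2 * (c * b\<^sup>2) + 2 * a\<^sup>2 + 2 * b\<^sup>2"
      by (simp add: algebra_simps)
    ultimately show ?thesis by linarith
  qed
  show ?thesis
  proof (rule that[of "2 * c + 2"])
    show "1 \<le> 2 * c + 2" by (simp add: c_def)
    fix j x
    show "(norm (schroedinger_cocycle E v j *v x))\<^sup>2 \<le> (2 * c + 2) * (norm x)\<^sup>2"
      unfolding norm_square_vec2 schroedinger_cocycle_mult by (rule *)
    define y where "y = matrix_inv (schroedinger_cocycle E v j) *v x"
    have "schroedinger_cocycle E v j *v y = x"
      unfolding y_def by (simp add: matrix_vector_mul_assoc matrix_inv_mult det_schroedinger_cocycle)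
    then have "x $ 1 = (E - v j) * y $ 1 - y $ 2" "x $ 2 = y $ 1"
      using schroedinger_cocycle_mult[of E v j y] by simp_all
    then have "y $ 1 = x $ 2" "y $ 2 = (E - v j) * x $ 2 - x $ 1" by simp_all
    then show "(norm y)\<^sup>2 \<le> (2 * c + 2) * (norm x)\<^sup>2"
      unfolding norm_square_vec2 using *[of j "x $ 2" "x $ 1"] by (simp add: add.commute)
  qed
qed

text \<open>The second coordinate of an orbit is the first one delayed by one step, so an orbit is
  the vector form of a solution of the second order recurrence.\<close>

lemma schroedinger_orbit:
  fixes x :: "real^2"
  obtains \<psi> where "\<And>n. n \<ge> j \<Longrightarrow> \<psi> (n + 1) = (E - v n) * \<psi> n - \<psi> (n - 1)"
    and "\<And>k. (norm (forward_iterate (schroedinger_cocycle E v) k j *v x))\<^sup>2 = (\<psi> (j + int k))\<^sup>2 + (\<psi> (j + int k - 1))\<^sup>2"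
proof
  let ?F = "\<lambda>k. forward_iterate (schroedinger_cocycle E v) k j *v x"
  \<comment> \<open>Left of \<open>j\<close> the value that matters is the one at
    \<open>j - 1\<close>, the second coordinate of the initial vector.\<close>
  define \<psi> where "\<psi> n = (if n < j then x $ 2 else ?F (nat (n - j)) $ 1)" for n
  have S: "?F (Suc k) = schroedinger_cocycle E v (j + int k) *v ?F k" for k
    by (simp add: matrix_vector_mul_assoc)
  have 1: "?F k $ 1 = \<psi> (j + int k)" for k
    by (simp add: \<psi>_def)
  have 2: "?F k $ 2 = \<psi> (j + int k - 1)" for k
  proof (cases k)
    case (Suc m)
    then show ?thesis unfolding Suc S schroedinger_cocycle_mult 1 by simp
  qed (simp add: \<psi>_def)
  show "(norm (?F k))\<^sup>2 = (\<psi> (j + int k))\<^sup>2 + (\<psi> (j + int k - 1))\<^sup>2" for k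
    unfolding norm_square_vec2 1 2 ..
  show "\<psi> (n + 1) = (E - v n) * \<psi> n - \<psi> (n - 1)" if "n \<ge> j" for n
  proof -
    define k where "k = nat (n - j)"
    have n: "n = j + int k" using that by (simp add: k_def)
    show ?thesis
      using S[of k] 1[of k] 1[of "Suc k"] 2[of k] schroedinger_cocycle_mult(1)[of E v "j + int k" "?F k"]
      by (simp add: n algebra_simps)
  qed
qed

section \<open>Cut-off solutions: from a lower bound on H - E to convexity\<close>

lemma ell2_finite_support:
  assumes "finite F" "\<And>n. n \<notin> F \<Longrightarrow> \<psi> n = 0"
  shows "\<psi> \<in> ell2" "(ell2_norm \<psi>)\<^sup>2 = (\<Sum>n\<in>F. (cmod (\<psi> n))\<^sup>2)"
proof -
  have *: "((\<lambda>n. (cmod (\<psi> n))\<^sup>2) has_sum (\<Sum>n\<in>F. (cmod (\<psi> n))\<^sup>2)) UNIV"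
    by (rule has_sum_finite_neutralI[OF assms(1)]) (auto simp: assms(2))
  then show "\<psi> \<in> ell2" by (auto simp: ell2_def summable_on_def)
  show "(ell2_norm \<psi>)\<^sup>2 = (\<Sum>n\<in>F. (cmod (\<psi> n))\<^sup>2)"
    unfolding ell2_norm_square using * by (rule infsumI)
qed

text \<open>A solution cut off to \<open>{a..b}\<close> is mapped by \<open>H - E\<close> to a sequence that lives at the two ends.\<close>

lemma solution_window_bound:
  fixes \<psi> :: "int \<Rightarrow> real"
  assumes K: "\<And>\<phi>. \<phi> \<in> ell2 \<Longrightarrow> (ell2_norm \<phi>)\<^sup>2 \<le> K * (ell2_norm (shifted_op v (of_real E) \<phi>))\<^sup>2"
    and ab: "a < b"
    and \<psi>: "\<And>n. a \<le> n \<Longrightarrow> \<psi> (n + 1) = (E - v n) * \<psi> n - \<psi> (n - 1)"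
  shows "(\<Sum>n=a..b. (\<psi> n)\<^sup>2) \<le> K * ((\<psi> a)\<^sup>2 + (\<psi> (a - 1))\<^sup>2 + ((\<psi> (b + 1))\<^sup>2 + (\<psi> b)\<^sup>2))"
proof -
  define \<phi> where "\<phi> n = complex_of_real (if n \<in> {a..b} then \<psi> n else 0)" for n
  \<comment> \<open>The defects of the cut-off: the sites just outside see \<open>\<psi> a\<close>
    and \<open>\<psi> b\<close>, the end sites miss \<open>\<psi> (a - 1)\<close> and
    \<open>\<psi> (b + 1)\<close>. By \<open>a < b\<close> the four sites are distinct.\<close>
  define h where "h n = (if n = a - 1 then \<psi> a else if n = a then - \<psi> (a - 1)
      else if n = b then - \<psi> (b + 1) else if n = b + 1 then \<psi> b else 0)" for n
  have h: "shifted_op v (of_real E) \<phi> n = of_real (h n)" for n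
  proof -
    consider "n < a - 1" | "n = a - 1" | "n = a" | "a < n" "n < b" | "n = b" | "n = b + 1" | "n > b + 1" by linarith
    then show ?thesis
    proof cases
      case 3
      then show ?thesis using ab \<psi>[of a]
        by (simp add: shifted_op_def schroedinger_op_def \<phi>_def h_def of_real_diff[symmetric] of_real_mult[symmetric] del: of_real_diff of_real_mult) (simp add: algebra_simps)
    next
      case 4
      then show ?thesis using ab \<psi>[of n]
        by (simp add: shifted_op_def schroedinger_op_def \<phi>_def h_def) (simp add: algebra_simps)
    next
      case 5
      then show ?thesis using ab \<psi>[of n]
        by (simp add: shifted_op_def schroedinger_op_def \<phi>_def h_def) (simp add: algebra_simps)
    qed (use ab in \<open>auto simp: shifted_op_def schroedinger_op_def \<phi>_def h_def\<close>)
  qed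
  have "\<phi> n = 0" if "n \<notin> {a..b}" for n
    using that unfolding \<phi>_def by (simp only: if_False of_real_0)
  note \<phi>' = ell2_finite_support[OF finite_atLeastAtMost_int this]
  have \<phi>: "\<phi> \<in> ell2" "(ell2_norm \<phi>)\<^sup>2 = (\<Sum>n=a..b. (cmod (\<phi> n))\<^sup>2)"
    by (rule \<phi>', assumption)+
  have "(ell2_norm (shifted_op v (of_real E) \<phi>))\<^sup>2 = (\<Sum>n\<in>{a - 1, a, b, b + 1}. (cmod (shifted_op v (of_real E) \<phi> n))\<^sup>2)"
    by (rule ell2_finite_support) (auto simp: h, auto simp: h_def)
  also have "\<dots> = (\<Sum>n\<in>{a - 1, a, b, b + 1}. (h n)\<^sup>2)" by (simp add: h)
  also have "\<dots> = (\<psi> a)\<^sup>2 + (\<psi> (a - 1))\<^sup>2 + ((\<psi> (b + 1))\<^sup>2 + (\<psi> b)\<^sup>2)"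
    using ab by (simp add: h_def)
  finally have "(ell2_norm (shifted_op v (of_real E) \<phi>))\<^sup>2 = \<dots>" .
  moreover have "(\<Sum>n=a..b. (cmod (\<phi> n))\<^sup>2) = (\<Sum>n=a..b. (\<psi> n)\<^sup>2)"
    by (rule sum.cong) (auto simp: \<phi>_def)
  ultimately show ?thesis using K[OF \<phi>(1)] \<phi>(2) by simp
qed

lemma sum_reindex_le:
  fixes f :: "'b \<Rightarrow> real"
  assumes "inj_on g I" "g ` I \<subseteq> W" "finite W" "\<And>n. f n \<ge> 0"
  shows "(\<Sum>i\<in>I. f (g i)) \<le> (\<Sum>n\<in>W. f n)"
proof -
  have "(\<Sum>i\<in>I. f (g i)) = sum f (g ` I)" using assms(1) by (simp add: sum.reindex)
  also have "\<dots> \<le> sum f W" using assms by (intro sum_mono2) auto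
  finally show ?thesis .
qed

text \<open>The window bound is used twice. Windows of radius \<open>1..m\<close> around the
  midpoint \<open>c\<close> bound \<open>P c\<close> by their end values; summed over the radii
  these ends are at most four copies of the mass \<open>S\<close> of the window of radius
  \<open>N\<close>, and \<open>S\<close> is in turn bounded by the outermost ends.\<close>

lemma bounded_below_imp_orbit_convex:
  assumes "bounded_below (shifted_op v (of_real E))"
  shows "\<exists>N. orbit_convex (schroedinger_cocycle E v) N"
proof -
  obtain K where K: "K > 0" "\<And>\<phi>. \<phi> \<in> ell2 \<Longrightarrow> (ell2_norm \<phi>)\<^sup>2 \<le> K * (ell2_norm (shifted_op v (of_real E) \<phi>))\<^sup>2"
    using assms unfolding bounded_below_def by blast
  \<comment> \<open>The two uses of the window bound give \<open>m P c \<le> 4 K^2 (...)\<close>,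
    and \<open>32 = 8 * 4\<close>.\<close>
  obtain m :: nat where m: "real m \<ge> 32 * K\<^sup>2" using real_arch_simple by blast
  \<comment> \<open>One more than the largest radius, so that the sites \<open>c - i - 1\<close> and
    \<open>c + i\<close> stay in the large window.\<close>
  define N where "N = Suc m"
  have "8 * (norm (forward_iterate (schroedinger_cocycle E v) N j *v x))\<^sup>2
      \<le> (norm x)\<^sup>2 + (norm (forward_iterate (schroedinger_cocycle E v) (2 * N) j *v x))\<^sup>2" for j x
  proof -
    obtain \<psi> where \<psi>: "\<And>n. n \<ge> j \<Longrightarrow> \<psi> (n + 1) = (E - v n) * \<psi> n - \<psi> (n - 1)"
      and x: "\<And>k. (norm (forward_iterate (schroedinger_cocycle E v) k j *v x))\<^sup>2 = (\<psi> (j + int k))\<^sup>2 + (\<psi> (j + int k - 1))\<^sup>2"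
      using schroedinger_orbit[of j E v x] by metis
    define P where "P n = (\<psi> n)\<^sup>2 + (\<psi> (n - 1))\<^sup>2" for n
    define c where "c = j + int N"
    have win: "(\<Sum>n=a..b. (\<psi> n)\<^sup>2) \<le> K * (P a + P (b + 1))" if "j \<le> a" "a < b" for a b
      using solution_window_bound[OF K(2) that(2), of \<psi>] \<psi> that(1) by (simp add: P_def)
    have Pc: "P c \<le> K * (P (c - int i) + P (c + int i))" if i: "i \<in> {1..m}" for i
    proof -
      have "P c = (\<Sum>n\<in>{c, c - 1}. (\<psi> n)\<^sup>2)" by (simp add: P_def)
      also have "\<dots> \<le> (\<Sum>n=c - int i..c + int i - 1. (\<psi> n)\<^sup>2)"
        using i by (intro sum_mono2) auto
      also have "\<dots> \<le> K * (P (c - int i) + P (c + int i))"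
      proof -
        have "j \<le> c - int i" "c - int i < c + int i - 1" using i by (auto simp: c_def N_def)
        from win[OF this] show ?thesis by simp
      qed
      finally show ?thesis .
    qed
    define S where "S = (\<Sum>n=c - int N..c + int N - 1. (\<psi> n)\<^sup>2)"
    have "real m * P c = (\<Sum>i\<in>{1..m}. P c)" by simp
    also have "\<dots> \<le> (\<Sum>i\<in>{1..m}. K * (P (c - int i) + P (c + int i)))"
      by (rule sum_mono) (rule Pc)
    also have "\<dots> = K * ((\<Sum>i\<in>{1..m}. (\<psi> (c - int i))\<^sup>2) + (\<Sum>i\<in>{1..m}. (\<psi> (c - int i - 1))\<^sup>2)
        + ((\<Sum>i\<in>{1..m}. (\<psi> (c + int i))\<^sup>2) + (\<Sum>i\<in>{1..m}. (\<psi> (c + int i - 1))\<^sup>2)))"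
      by (simp add: P_def sum_distrib_left[symmetric] sum.distrib)
    \<comment> \<open>Each of the four sums runs over distinct sites of the window that defines
      \<open>S\<close>.\<close>
    also have "\<dots> \<le> K * ((S + S) + (S + S))"
      unfolding S_def using K(1)
      by (intro mult_left_mono add_mono sum_reindex_le) (auto simp: N_def inj_on_def)
    also have "\<dots> = 4 * K * S" by simp
    also have "\<dots> \<le> 4 * K * (K * (P (c - int N) + P (c + int N)))"
    proof (rule mult_left_mono)
      have "j \<le> c - int N" "c - int N < c + int N - 1" by (auto simp: c_def N_def)
      from win[OF this] show "S \<le> K * (P (c - int N) + P (c + int N))" by (simp add: S_def)
    qed (use K(1) in simp)
    finally have "real m * P c \<le> 4 * K\<^sup>2 * (P (c - int N) + P (c + int N))"
      by (simp add: power2_eq_square mult.assoc)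
    moreover have "32 * K\<^sup>2 * P c \<le> real m * P c"
      by (intro mult_right_mono m) (simp add: P_def)
    ultimately have "4 * K\<^sup>2 * (8 * P c) \<le> 4 * K\<^sup>2 * (P (c - int N) + P (c + int N))"
      by linarith
    then have "8 * P c \<le> P (c - int N) + P (c + int N)"
      using K(1) by (subst (asm) mult_le_cancel_left_pos) auto
    then show ?thesis
      using x[of 0] x[of N] x[of "2 * N"] by (simp add: P_def c_def algebra_simps)
  qed
  then have "orbit_convex (schroedinger_cocycle E v) N" by (simp add: orbit_convex_def N_def)
  then show ?thesis ..
qed

subsection \<open>Stable lines\<close>

text \<open>An area-preserving map cannot expand every direction: the preimages of the two basis
  vectors cannot both be shorter than 1, and normalising one that is not gives the vector.\<close>

lemma unit_vector_not_expanded: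
  fixes B :: "real^2^2"
  assumes "det B = 1"
  obtains x where "norm x = 1" "norm (B *v x) \<le> 1"
proof -
  have unit: "\<exists>x. norm x = 1 \<and> norm (B *v x) \<le> 1" if "norm y \<ge> 1" "norm (B *v y) = 1" for y
  proof (intro exI[of _ "(1 / norm y) *\<^sub>R y"] conjI)
    show "norm ((1 / norm y) *\<^sub>R y) = 1" using that(1) by auto
    show "norm (B *v ((1 / norm y) *\<^sub>R y)) \<le> 1"
      using that by (simp add: matrix_vector_mult_scaleR divide_le_eq)
  qed
  define a b c d where "a = B $ 1 $ 1" and "b = B $ 1 $ 2" and "c = B $ 2 $ 1" and "d = B $ 2 $ 2"
  have det: "a * d - b * c = 1" using assms by (simp add: det_2 a_def b_def c_def d_def)
  \<comment> \<open>\<open>y1\<close> and \<open>y2\<close> are the columns of the inverse of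
    \<open>B\<close>.\<close>
  define y1 :: "real^2" where "y1 = vector [d, - c]"
  define y2 :: "real^2" where "y2 = vector [- b, a]"
  have n: "(norm y1)\<^sup>2 = d\<^sup>2 + c\<^sup>2" "(norm y2)\<^sup>2 = b\<^sup>2 + a\<^sup>2"
    by (simp_all add: norm_square_vec2 y1_def y2_def)
  have B1: "(B *v y1) $ 1 = a * d - b * c" "(B *v y1) $ 2 = 0"
    by (simp_all add: matrix_vector_mult_def sum_2 y1_def a_def b_def c_def d_def)
  have B2: "(B *v y2) $ 1 = 0" "(B *v y2) $ 2 = a * d - b * c"
    by (simp_all add: matrix_vector_mult_def sum_2 y2_def a_def b_def c_def d_def)
  have "(norm (B *v y1))\<^sup>2 = 1" "(norm (B *v y2))\<^sup>2 = 1"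
    unfolding norm_square_vec2 B1 B2 by (simp_all add: det)
  then have B: "norm (B *v y1) = 1" "norm (B *v y2) = 1"
    by (simp_all add: power2_eq_1_iff order.strict_trans2[OF _ norm_ge_zero])
       (metis norm_ge_zero not_one_le_zero neg_0_le_iff_le)+
  have "norm y1 \<ge> 1 \<or> norm y2 \<ge> 1"
  proof (rule ccontr)
    assume "\<not> ?thesis"
    then have "(norm y1)\<^sup>2 < 1" "(norm y2)\<^sup>2 < 1" by (simp_all add: power_less_one_iff abs_square_less_1)
    then have "(d\<^sup>2 + c\<^sup>2) * (b\<^sup>2 + a\<^sup>2) < 1 * 1"
      unfolding n by (intro mult_strict_mono) auto
    \<comment> \<open>Lagrange's identity: the product of the squared lengths is at least the
      squared determinant.\<close>
    moreover have "(d\<^sup>2 + c\<^sup>2) * (b\<^sup>2 + a\<^sup>2) = (a * d - b * c)\<^sup>2 + (a * c + b * d)\<^sup>2"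
      by (simp add: power2_eq_square algebra_simps)
    ultimately show False by (simp add: det)
  qed
  with unit B that show ?thesis by blast
qed

text \<open>A single increase would propagate and force exponential growth, against the bound. Hence
  the sequence never increases, and convexity then gives \<open>7 * q (Suc k) \<le> q k\<close>,
  more than the factor 4 claimed.\<close>

lemma bounded_convex_sequence_decays:
  fixes q :: "nat \<Rightarrow> real"
  assumes q: "\<And>k. 8 * q (Suc k) \<le> q k + q (Suc (Suc k))" "\<And>k. q k \<ge> 0"
    and bd: "\<And>k. q k \<le> Q"
  shows "q k \<le> (1/4) ^ k * q 0"
proof -
  have mono: "q (Suc k) \<le> q k" for k
  proof (rule ccontr)
    assume "\<not> q (Suc k) \<le> q k"
    then have k: "q k < q (Suc k)" by simp
    \<comment> \<open>The two claims are proved together: once the sequence has not decreased,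
      convexity gives a factor 7 at the next step, of which 2 is kept.\<close>
    have "q (k + m) \<le> q (k + Suc m) \<and> 2 ^ m * q (Suc k) \<le> q (k + Suc m)" for m
    proof (induction m)
      case (Suc m)
      then show ?case using q(1)[of "k + m"] q(2)[of "k + m"] q(2)[of "k + Suc m"]
        by simp
    qed (use k in simp)
    then have "2 ^ m * q (Suc k) \<le> Q" for m using bd order_trans by blast
    moreover obtain m where "Q / q (Suc k) < 2 ^ m" using real_arch_pow[of 2] by auto
    ultimately show False using k q(2)[of k] by (force simp: field_simps not_le[symmetric])
  qed
  show ?thesis
  proof (induction k)
    case (Suc k)
    then show ?case using q(1)[of k] mono[of "Suc k"] q(2)[of k] q(2)[of "Suc k"] by simp
  qed simp
qed

text \<open>A maximum principle: at an interior maximum \<open>m\<close> convexity gives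
  \<open>8 * q m \<le> 2 * q m\<close>, so \<open>q m\<close> is not positive.\<close>

lemma convex_sequence_max:
  fixes q :: "nat \<Rightarrow> real"
  assumes q: "\<And>k. 8 * q (Suc k) \<le> q k + q (Suc (Suc k))" "\<And>k. q k \<ge> 0"
    and ends: "q 0 \<le> 1" "q n \<le> 1" and "i \<le> n"
  shows "q i \<le> 1"
proof -
  obtain m where m: "m \<le> n" "\<And>i. i \<le> n \<Longrightarrow> q i \<le> q m"
  proof -
    have "Max (q ` {..n}) \<in> q ` {..n}" by (intro Max_in) auto
    then obtain m where "m \<in> {..n}" "Max (q ` {..n}) = q m" by (rule imageE)
    moreover have "q i \<le> Max (q ` {..n})" if "i \<le> n" for i
      using that by (intro Max_ge) auto
    ultimately show ?thesis using that[of m] by simp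
  qed
  have "q m \<le> 1"
  proof (cases "m = 0 \<or> m = n")
    case False
    then obtain k where k: "m = Suc k" by (cases m) auto
    then show ?thesis using q(1)[of k] m(2)[of k] m(2)[of "Suc (Suc k)"] m(1) False by simp
  qed (use ends in auto)
  with m(2)[OF \<open>i \<le> n\<close>] show ?thesis by simp
qed

text \<open>\<open>B\<close> will be the forward or the backward iterates from a fixed site.
  Boundedness is what the compactness argument delivers; convexity upgrades it to exponential
  decay.\<close>

definition stable_space :: "(nat \<Rightarrow> real^2^2) \<Rightarrow> (real^2) set" where
  "stable_space B = {x. bounded (range (\<lambda>n. B n *v x))}"

lemma subspace_stable_space: "subspace (stable_space B)"
proof -
  have "x + y \<in> stable_space B" if "x \<in> stable_space B" "y \<in> stable_space B" for x y
  proof -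
    obtain a b where ab: "\<And>n. norm (B n *v x) \<le> a" "\<And>n. norm (B n *v y) \<le> b"
      using \<open>x \<in> _\<close> \<open>y \<in> _\<close> unfolding stable_space_def bounded_iff by auto
    have "norm (B n *v (x + y)) \<le> a + b" for n
      using norm_triangle_mono[OF ab] by (simp add: matrix_vector_right_distrib)
    then show ?thesis unfolding stable_space_def bounded_iff by auto
  qed
  moreover have "r *\<^sub>R x \<in> stable_space B" if "x \<in> stable_space B" for r x
    using bounded_scaling[of "range (\<lambda>n. B n *v x)" r] that
    by (simp add: stable_space_def matrix_vector_mult_scaleR image_image)
  ultimately show ?thesis by (simp add: subspace_def) (simp add: stable_space_def)
qed

lemma iterated_growth:
  fixes B :: "nat \<Rightarrow> real^2^2"
  assumes M: "M \<ge> 1" and growth: "\<And>n x. norm (B (Suc n) *v x) \<le> M * norm (B n *v x)"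
  shows "norm (B (n + i) *v x) \<le> M ^ i * norm (B n *v x)"
proof (induction i)
  case (Suc i)
  have "norm (B (n + Suc i) *v x) \<le> M * norm (B (n + i) *v x)"
    using growth[of "n + i" x] by simp
  also have "\<dots> \<le> M * (M ^ i * norm (B n *v x))"
    using M by (intro mult_left_mono Suc) simp
  finally show ?case by (simp add: mult.assoc)
qed simp

text \<open>Along multiples of \<open>N\<close> the squared norms form a bounded convex sequence, so
  the norm at least halves every \<open>N\<close> steps; hence the rate
  \<open>2 powr (1 / N)\<close>. The fewer than \<open>N\<close> remaining steps cost
  \<open>M ^ N\<close> and the factor 2.\<close>

lemma stable_space_decay:
  assumes N: "N \<ge> 1" and M: "M \<ge> 1"
    and B0: "B 0 = mat 1"
    and growth: "\<And>n x. norm (B (Suc n) *v x) \<le> M * norm (B n *v x)"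
    and conv: "\<And>n x. 8 * (norm (B (n + N) *v x))\<^sup>2 \<le> (norm (B n *v x))\<^sup>2 + (norm (B (n + 2 * N) *v x))\<^sup>2"
    and x: "x \<in> stable_space B"
  shows "norm (B n *v x) \<le> 2 * M ^ N * (2 powr (1 / N)) powi (- int n) * norm x"
proof -
  define lam :: real where "lam = 2 powr (1 / N)"
  have lam: "lam \<ge> 1" "lam ^ N = 2"
    using N by (simp_all add: lam_def ge_one_powr_ge_zero powr_realpow[symmetric] powr_powr)
  define k r where "k = n div N" and "r = n mod N"
  have n: "n = k * N + r" and r: "r < N" using N by (auto simp: k_def r_def)
  define q where "q i = (norm (B (i * N) *v x))\<^sup>2" for i
  obtain b where b: "\<And>n. norm (B n *v x) \<le> b"
    using x unfolding stable_space_def bounded_iff by auto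
  have "q k \<le> (1/4) ^ k * q 0"
  proof (rule bounded_convex_sequence_decays)
    show "8 * q (Suc i) \<le> q i + q (Suc (Suc i))" for i
      using conv[of "i * N" x] by (simp add: q_def algebra_simps mult_2_right)
    show "0 \<le> q i" "q i \<le> b\<^sup>2" for i by (auto simp: q_def intro: power_mono b)
  qed
  then have "(norm (B (k * N) *v x))\<^sup>2 \<le> ((1/2) ^ k * norm x)\<^sup>2"
    by (simp add: q_def B0 power_mult_distrib power_even_eq[symmetric] flip: power_mult)
      (simp add: power_mult mult.commute[of k] power2_eq_square)
  then have k: "norm (B (k * N) *v x) \<le> (1/2) ^ k * norm x"
    by (rule power2_le_imp_le) simp
  have "norm (B n *v x) \<le> M ^ r * norm (B (k * N) *v x)"
    unfolding n by (rule iterated_growth[of M B, OF M growth])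
  also have "\<dots> \<le> M ^ r * ((1/2) ^ k * norm x)"
    using M by (intro mult_left_mono k) simp
  also have "\<dots> \<le> M ^ N * ((1/2) ^ k * norm x)"
    using M r by (intro mult_right_mono power_increasing) auto
  \<comment> \<open>Holds because \<open>n < (k + 1) * N\<close> and
    \<open>lam ^ N = 2\<close>.\<close>
  also have "(1/2) ^ k \<le> 2 * lam powi (- int n)"
  proof -
    have "lam ^ n = 2 ^ k * lam ^ r"
      unfolding n power_add mult.commute[of k] power_mult lam(2) ..
    also have "\<dots> \<le> 2 ^ k * lam ^ N"
      using lam(1) r by (intro mult_left_mono power_increasing) auto
    finally have "lam ^ n \<le> 2 * 2 ^ k" by (simp add: lam(2))
    then show ?thesis using lam(1) by (simp add: power_int_minus field_simps)
  qed
  finally show ?thesis using M by (simp add: lam_def mult_left_mono mult_right_mono mult.assoc mult.left_commute)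
qed

text \<open>The line is nonzero because the closed sets of unit vectors that are not expanded up to time
  \<open>k\<close> are nested, and it is not the whole plane because determinants do not decay.\<close>

lemma stable_space_RP1:
  assumes N: "N \<ge> 1" and M: "M \<ge> 1"
    and B0: "B 0 = mat 1" and det: "\<And>n. det (B n) = 1"
    and growth: "\<And>n x. norm (B (Suc n) *v x) \<le> M * norm (B n *v x)"
    and conv: "\<And>n x. 8 * (norm (B (n + N) *v x))\<^sup>2 \<le> (norm (B n *v x))\<^sup>2 + (norm (B (n + 2 * N) *v x))\<^sup>2"
  shows "stable_space B \<in> RP1"
proof -
  let ?q = "\<lambda>x i. (norm (B (i * N) *v x))\<^sup>2"
  have q: "8 * ?q x (Suc i) \<le> ?q x i + ?q x (Suc (Suc i))" for x i
    using conv[of "i * N" x] by (simp add: algebra_simps mult_2_right)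
  have "stable_space B \<noteq> {0}"
  proof -
    define F where "F k = sphere 0 1 \<inter> (\<Inter>i\<le>k. {x. ?q x i \<le> 1})" for k
    have "\<Inter> (range F) \<noteq> {}"
    proof (rule compact_nest)
      have "closed {x. ?q x i \<le> 1}" for i
        by (intro closed_Collect_le continuous_on_power continuous_on_norm continuous_on_const
            linear_continuous_on matrix_vector_mul_bounded_linear)
      then show "compact (F k)" for k
        unfolding F_def by (intro compact_Int_closed compact_sphere closed_INT ballI)
      show "F k \<noteq> {}" for k
      proof -
        obtain x where x: "norm x = 1" "norm (B (k * N) *v x) \<le> 1"
          using unit_vector_not_expanded[OF det] by blast
        \<comment> \<open>The vector is controlled only at times \<open>0\<close> and
          \<open>k * N\<close>; the maximum principle covers the multiples of \<open>N\<close> in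
          between.\<close>
        have "?q x i \<le> 1" if "i \<le> k" for i
          by (rule convex_sequence_max[of "?q x", OF q _ _ _ that])
             (use x in \<open>simp_all add: B0 power_le_one\<close>)
        with x(1) have "x \<in> F k" by (auto simp: F_def)
        then show ?thesis by blast
      qed
      show "F n \<subseteq> F m" if "m \<le> n" for m n
        unfolding F_def using that order_trans by blast
    qed
    then obtain x where x: "\<And>k. x \<in> F k" by blast
    then have x1: "norm x = 1" and qx: "?q x k \<le> 1" for k unfolding F_def by force+
    have "norm (B n *v x) \<le> M ^ N" for n
    proof -
      have "norm (B n *v x) \<le> M ^ (n mod N) * norm (B (n div N * N) *v x)"
        using iterated_growth[of M B, OF M growth, of "n div N * N" "n mod N" x] by simp
      also have "\<dots> \<le> M ^ N * 1"
        using M N qx[of "n div N"] by (intro mult_mono power_increasing) (auto simp: abs_square_le_1)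
      finally show ?thesis by simp
    qed
    then have "x \<in> stable_space B" by (auto simp: stable_space_def bounded_iff)
    moreover have "x \<noteq> 0" using x1 by force
    ultimately show ?thesis by blast
  qed
  then have "dim (stable_space B) \<noteq> 0"
    using subspace_0[OF subspace_stable_space[of B]] unfolding dim_eq_0 by blast
  moreover have "dim (stable_space B) \<noteq> 2"
  proof
    assume "dim (stable_space B) = 2"
    then have "span (stable_space B) = UNIV" using dim_eq_full[of "stable_space B"] by simp
    then have UNIV: "stable_space B = UNIV"
      using subspace_stable_space span_eq_iff by blast
    define lam :: real where "lam = 2 powr (1 / N)"
    have lam: "lam > 1" using N by (simp add: lam_def)
    have "(\<lambda>n. inverse lam ^ n) \<longlonglongrightarrow> 0"
      using lam by (intro LIMSEQ_power_zero) (simp add: inverse_less_1_iff)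
    then have z: "(\<lambda>n. 2 * M ^ N * inverse lam ^ n * norm x) \<longlonglongrightarrow> 0" for x :: "real^2"
      by (auto intro: tendsto_mult_left_zero tendsto_mult_right_zero)
    have "(\<lambda>n. B n *v x) \<longlonglongrightarrow> 0" for x
      using stable_space_decay[of N M B x, OF N M B0 growth conv] UNIV
      by (intro Lim_null_comparison[OF _ z[of x]]) (auto simp: lam_def power_int_minus power_inverse)
    \<comment> \<open>Decay of the images of the basis vectors is decay of all matrix entries, so
      the determinants would tend to 0.\<close>
    then have "(\<lambda>n. (B n *v axis j 1) $ i) \<longlonglongrightarrow> 0 $ i" for i j
      by (intro tendsto_vec_nth)
    then have "(\<lambda>n. B n $ i $ j) \<longlonglongrightarrow> 0" for i j
      by (simp add: matrix_vector_mult_basis column_def)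
    then have "(\<lambda>n. det (B n)) \<longlonglongrightarrow> 0 * 0 - 0 * 0"
      unfolding det_2 by (intro tendsto_intros)
    then have "(\<lambda>n. 1::real) \<longlonglongrightarrow> 0" by (simp add: det)
    then show False by (simp add: LIMSEQ_const_iff)
  qed
  moreover have "dim (stable_space B) \<le> 2"
    using dim_subset_UNIV[of "stable_space B"] by simp
  ultimately have "dim (stable_space B) = 1" by linarith
  then show ?thesis by (simp add: RP1_def subspace_stable_space)
qed

subsection \<open>Orbit convexity and uniform hyperbolicity\<close>

text \<open>The two orbits differ by one initial term, which does not affect boundedness. Invariance
  of the line fields comes from here.\<close>

lemma stable_space_shift:
  assumes "\<And>n. B (Suc n) = B' n ** C"
  shows "x \<in> stable_space B \<longleftrightarrow> C *v x \<in> stable_space B'"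
proof -
  have "range (\<lambda>n. B n *v x) = insert (B 0 *v x) (range (\<lambda>n. B (Suc n) *v x))"
    by (subst UNIV_nat_eq) (simp add: image_image)
  also have "range (\<lambda>n. B (Suc n) *v x) = range (\<lambda>n. B' n *v (C *v x))"
    by (simp add: assms matrix_vector_mul_assoc)
  finally show ?thesis by (simp add: stable_space_def)
qed

text \<open>\<open>s j\<close> and \<open>u j\<close> are the stable spaces of the forward and
  backward iterates from \<open>j\<close>; both families satisfy the growth, determinant and
  convexity conditions of the preceding lemmas.\<close>

lemma orbit_convex_imp_uniformly_hyperbolic:
  assumes v: "bounded (range v)" and conv: "orbit_convex (schroedinger_cocycle E v) N"
  shows "uniformly_hyperbolic (schroedinger_cocycle E v)"
proof -
  define A where "A = schroedinger_cocycle E v"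
  have N: "N \<ge> 1" and conv: "\<And>j x. 8 * (norm (forward_iterate A N j *v x))\<^sup>2
     \<le> (norm x)\<^sup>2 + (norm (forward_iterate A (2 * N) j *v x))\<^sup>2"
    using conv unfolding orbit_convex_def A_def by auto
  have det: "det (A j) = 1" for j unfolding A_def by (rule det_schroedinger_cocycle)
  obtain M where M: "M \<ge> 1" and M1: "\<And>j x. (norm (A j *v x))\<^sup>2 \<le> M * (norm x)\<^sup>2"
    and M2: "\<And>j x. (norm (matrix_inv (A j) *v x))\<^sup>2 \<le> M * (norm x)\<^sup>2"
    using schroedinger_cocycle_bounded[OF v, of E] unfolding A_def by metis
  \<comment> \<open>By \<open>M \<ge> 1\<close> the factor \<open>M\<close> may replace its square
    root.\<close>
  have sq: "norm y \<le> M * norm x" if "(norm y)\<^sup>2 \<le> M * (norm x)\<^sup>2" for x y :: "real^2"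
  proof (rule power2_le_imp_le)
    have "M * (norm x)\<^sup>2 \<le> M\<^sup>2 * (norm x)\<^sup>2"
      using M by (intro mult_right_mono) (auto simp: power2_eq_square)
    with that show "(norm y)\<^sup>2 \<le> (M * norm x)\<^sup>2" by (simp add: power_mult_distrib)
  qed (use M in simp)
  define F where "F j n = forward_iterate A n j" for j n
  define G where "G j n = backward_iterate A n j" for j n
  have F0: "F j 0 = mat 1" and G0: "G j 0 = mat 1" for j by (simp_all add: F_def G_def)
  have detF: "det (F j n) = 1" and detG: "det (G j n) = 1" for j n
    unfolding F_def G_def by (simp_all add: det_forward_iterate det_backward_iterate det)
  have Fg: "norm (F j (Suc n) *v x) \<le> M * norm (F j n *v x)" for j n x
    using sq[OF M1] by (simp add: F_def flip: matrix_vector_mul_assoc)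
  have Gg: "norm (G j (Suc n) *v x) \<le> M * norm (G j n *v x)" for j n x
    using sq[OF M2] by (simp add: G_def flip: matrix_vector_mul_assoc)
  have Fc: "8 * (norm (F j (n + N) *v x))\<^sup>2 \<le> (norm (F j n *v x))\<^sup>2 + (norm (F j (n + 2 * N) *v x))\<^sup>2" for j n x
    using conv[of "j + int n" "F j n *v x"]
    by (simp add: F_def forward_iterate_add matrix_vector_mul_assoc)
  have G_back: "forward_iterate A m (j - int n - int m) ** G j (n + m) = G j n" for j n m
    by (simp add: G_def backward_iterate_add matrix_mul_assoc forward_backward_iterate det)
  \<comment> \<open>Forward convexity is applied at the far end: starting from
    \<open>G j (n + 2 * N) *v x\<close>, the orbit reaches \<open>G j (n + N) *v x\<close> and then
    \<open>G j n *v x\<close>.\<close>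
  have Gc: "8 * (norm (G j (n + N) *v x))\<^sup>2 \<le> (norm (G j n *v x))\<^sup>2 + (norm (G j (n + 2 * N) *v x))\<^sup>2" for j n x
  proof -
    have e: "j - int n - int (2 * N) = j - int (n + N) - int N" "n + 2 * N = n + N + N" by simp_all
    have "forward_iterate A N (j - int n - int (2 * N)) ** G j (n + 2 * N) = G j (n + N)"
      unfolding e by (rule G_back)
    then show ?thesis
      using conv[of "j - int n - int (2 * N)" "G j (n + 2 * N) *v x"]
      unfolding matrix_vector_mul_assoc G_back by simp
  qed
  define s where "s j = stable_space (F j)" for j
  define u where "u j = stable_space (G j)" for j
  define lam :: real where "lam = 2 powr (1 / N)"
  have lam: "lam > 1" using N by (simp add: lam_def)
  have RP1: "u j \<in> RP1" "s j \<in> RP1" for j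
    unfolding u_def s_def
    by (rule stable_space_RP1[of N M, OF N M G0 detG Gg Gc], rule stable_space_RP1[of N M, OF N M F0 detF Fg Fc])
  have decay: "norm (F j n *v x) \<le> 2 * M ^ N * lam powi (- int n) * norm x" if "x \<in> s j" for j n x
    using that unfolding s_def lam_def by (rule stable_space_decay[OF N M F0 Fg Fc])
  have decay': "norm (G j n *v x) \<le> 2 * M ^ N * lam powi (- int n) * norm x" if "x \<in> u j" for j n x
    using that unfolding u_def lam_def by (rule stable_space_decay[OF N M G0 Gg Gc])
  have inv: "A j *v (matrix_inv (A j) *v x) = x" "matrix_inv (A j) *v (A j *v x) = x" for j x
    by (simp_all add: matrix_vector_mul_assoc matrix_inv_mult det)
  have s: "x \<in> s j \<longleftrightarrow> A j *v x \<in> s (j + 1)" for j x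
    unfolding s_def by (rule stable_space_shift) (unfold F_def, rule forward_iterate_Suc2)
  \<comment> \<open>For \<open>u\<close> the shift runs backwards: the first backward step from
    \<open>j + 1\<close> is the inverse of \<open>A j\<close>.\<close>
  have u: "x \<in> u (j + 1) \<longleftrightarrow> matrix_inv (A j) *v x \<in> u j" for j x
    unfolding u_def by (rule stable_space_shift) (use backward_iterate_Suc2[of A _ "j + 1"] in \<open>simp add: G_def\<close>)
  have act: "line_action (A j) (u j) = u (j + 1)" "line_action (A j) (s j) = s (j + 1)" for j
    unfolding line_action_def
  proof (safe)
    fix x assume "x \<in> u (j + 1)"
    then show "x \<in> (*v) (A j) ` u j" using u inv(1) by (metis image_eqI)
  next
    fix x assume "x \<in> s (j + 1)"
    then show "x \<in> (*v) (A j) ` s j" using s inv(1) by (metis image_eqI)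
  qed (simp_all add: u inv s[symmetric])
  have it: "iterate A (- n) j = G j (nat n)" "iterate A n j = F j (nat n)" if "n \<ge> 1" for n j
    using that by (auto simp: iterate_def F_def G_def)
  have "norm (iterate A (- n) j *v x) \<le> 2 * M ^ N * lam powi (- n)" if "n \<ge> 1" "x \<in> u j" "norm x = 1" for n j x
    using decay'[OF that(2), of "nat n"] that it by simp
  moreover have "norm (iterate A n j *v x) \<le> 2 * M ^ N * lam powi (- n)" if "n \<ge> 1" "x \<in> s j" "norm x = 1" for n j x
    using decay[OF that(2), of "nat n"] that it by simp
  moreover have "2 * M ^ N > 0" using M by simp
  ultimately have "uniformly_hyperbolic A"
    unfolding uniformly_hyperbolic_def using RP1 act lam
    by (intro exI[of _ u] exI[of _ s] conjI allI exI[of _ "2 * M ^ N"] exI[of _ lam] impI ballI) auto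
  then show ?thesis by (simp add: A_def)
qed

text \<open>For large \<open>N\<close>, the part of an orbit along \<open>u\<close> grows by a
  factor of at least 8 in \<open>N\<close> steps and the part along \<open>s\<close> shrinks by as
  much. At the middle time each part is therefore dominated by its value at one of the ends.\<close>

lemma uniformly_hyperbolic_imp_orbit_convex:
  assumes det: "\<And>j. det (A j) = 1" and "uniformly_hyperbolic A"
  shows "\<exists>N. orbit_convex A N"
proof -
  obtain u s C lam where RP1: "\<And>j. u j \<in> RP1" "\<And>j. s j \<in> RP1"
    and act: "\<And>j. line_action (A j) (u j) = u (j + 1)" "\<And>j. line_action (A j) (s j) = s (j + 1)"
    and C: "C > 0" and lam: "lam > 1"
    and dec: "\<And>n j x. n \<ge> 1 \<Longrightarrow> x \<in> u j \<Longrightarrow> norm x = 1 \<Longrightarrow> norm (iterate A (- n) j *v x) \<le> C * lam powi (- n)"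
       "\<And>n j x. n \<ge> 1 \<Longrightarrow> x \<in> s j \<Longrightarrow> norm x = 1 \<Longrightarrow> norm (iterate A n j *v x) \<le> C * lam powi (- n)"
    using assms(2) unfolding uniformly_hyperbolic_def by metis
  have sub: "subspace (u j)" "subspace (s j)" "dim (u j) = 1" "dim (s j) = 1" for j
    using RP1[of j] by (auto simp: RP1_def)
  have "(\<lambda>n. C * inverse lam ^ n) \<longlonglongrightarrow> C * 0"
    using lam by (intro tendsto_intros LIMSEQ_power_zero) (simp add: inverse_less_1_iff)
  then have "eventually (\<lambda>n. C * inverse lam ^ n < 1/8) sequentially"
    by (intro order_tendstoD) auto
  then obtain N0 where N0: "\<And>n. n \<ge> N0 \<Longrightarrow> C * inverse lam ^ n < 1/8"
    unfolding eventually_sequentially by blast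
  define N where "N = max 1 N0"
  have N: "N \<ge> 1" "C * inverse lam ^ N < 1/8"
    unfolding N_def by (simp, rule N0) simp
  define r where "r = C * inverse lam ^ N"
  have r: "0 \<le> r" "r < 1/8" "r = C * lam powi (- int N)"
    using N C lam by (auto simp: r_def power_int_minus power_inverse)
  have scale: "norm (B *v x) \<le> r * norm x"
    if "subspace L" "x \<in> L" and *: "\<And>y. y \<in> L \<Longrightarrow> norm y = 1 \<Longrightarrow> norm (B *v y) \<le> r"
    for B :: "real^2^2" and x L
  proof (cases "x = 0")
    case False
    have "norm (B *v ((1 / norm x) *\<^sub>R x)) \<le> r"
      using False by (intro * subspace_scale that) auto
    then show ?thesis using False by (simp add: matrix_vector_mult_scaleR field_simps)
  qed simp
  have du: "norm (backward_iterate A N j *v x) \<le> r * norm x" if "x \<in> u j" for j x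
    using dec(1)[of "int N" _ j] N(1) by (intro scale[OF sub(1) that]) (simp add: iterate_def r(3))
  have ds: "norm (forward_iterate A N j *v x) \<le> r * norm x" if "x \<in> s j" for j x
    using dec(2)[of "int N" _ j] N(1) by (intro scale[OF sub(2) that]) (simp add: iterate_def r(3))
  have inv: "forward_iterate A n j *v x \<in> L (j + int n)"
    if "\<And>j. line_action (A j) (L j) = L (j + 1)" "x \<in> L j" for n j x L
  proof (induction n)
    case (Suc n)
    then have "A (j + int n) *v (forward_iterate A n j *v x) \<in> line_action (A (j + int n)) (L (j + int n))"
      unfolding line_action_def by (rule imageI)
    then show ?case by (simp add: that(1) matrix_vector_mul_assoc algebra_simps)
  qed (simp add: that(2))
  \<comment> \<open>Backward contraction at the image point, read as forward expansion.\<close>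
  have exp: "norm x \<le> r * norm (forward_iterate A N j *v x)" if "x \<in> u j" for x j
    using du[OF inv[of u, OF act(1) that], of N]
    by (simp add: matrix_vector_mul_assoc backward_forward_iterate det)
  have "8 * (norm (forward_iterate A N j *v x))\<^sup>2 \<le> (norm x)\<^sup>2 + (norm (forward_iterate A (2 * N) j *v x))\<^sup>2" for j x
  proof -
    let ?D = "\<lambda>j x. forward_iterate A N j *v x"
    \<comment> \<open>A common vector would be both expanded and contracted. So the lines meet only
      in 0 and, by dimension, span the plane.\<close>
    have "y = 0" if "y \<in> u j" "y \<in> s j" for y
    proof -
      have "norm y \<le> r * (r * norm y)"
        using exp[OF that(1)] mult_left_mono[OF ds[OF that(2)] r(1)] by linarith
      also have "\<dots> \<le> 1/8 * (1/8 * norm y)"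
        using r by (intro mult_mono) auto
      finally show ?thesis by simp
    qed
    then have "u j \<inter> s j \<subseteq> {0}" by blast
    then have Z: "dim (u j \<inter> s j) = 0" by (simp only: dim_eq_0)
    have "dim {a + b |a b. a \<in> u j \<and> b \<in> s j} = DIM(real^2)"
      using dim_sums_Int[OF sub(1,2), of j j] unfolding Z sub(3,4) by simp
    then have "{a + b |a b. a \<in> u j \<and> b \<in> s j} = UNIV"
      using subspace_sums[OF sub(1,2), of j j, THEN span_eq_iff[THEN iffD2]] by (simp only: dim_eq_full)
    then have "x \<in> {a + b |a b. a \<in> u j \<and> b \<in> s j}" by simp
    then obtain a b where x: "x = a + b" and a: "a \<in> u j" and b: "b \<in> s j" by blast
    define a1 a2 b1 b2 where "a1 = ?D j a" and "a2 = ?D (j + int N) a1" and "b1 = ?D j b" and "b2 = ?D (j + int N) b1"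
    have le: "norm a \<le> 1/8 * norm a1" "norm a1 \<le> 1/8 * norm a2" "norm b1 \<le> 1/8 * norm b" "norm b2 \<le> 1/8 * norm b1"
    proof -
      have *: "p \<le> 1/8 * norm q" if "p \<le> r * norm q" for p and q :: "real^2"
        using that mult_right_mono[OF less_imp_le[OF r(2)] norm_ge_zero, of q] by linarith
      have 1: "a1 \<in> u (j + int N)" "b1 \<in> s (j + int N)"
        unfolding a1_def b1_def by (rule inv[of u, OF act(1) a], rule inv[of s, OF act(2) b])
      show "norm a \<le> 1/8 * norm a1" unfolding a1_def by (rule *[OF exp[OF a]])
      show "norm a1 \<le> 1/8 * norm a2" unfolding a2_def by (rule *[OF exp[OF 1(1)]])
      show "norm b1 \<le> 1/8 * norm b" unfolding b1_def by (rule *[OF ds[OF b]])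
      show "norm b2 \<le> 1/8 * norm b1" unfolding b2_def by (rule *[OF ds[OF 1(2)]])
    qed
    have x1: "?D j x = a1 + b1" by (simp add: x a1_def b1_def matrix_vector_right_distrib)
    have x2: "forward_iterate A (2 * N) j *v x = a2 + b2"
      by (simp add: x a1_def b1_def a2_def b2_def matrix_vector_right_distrib mult_2 forward_iterate_add flip: matrix_vector_mul_assoc)
    define p q t where "p = norm x" and "q = norm (a2 + b2)" and "t = norm (a1 + b1)"
    have "p \<ge> norm b - norm a" unfolding p_def x by (metis add.commute norm_diff_ineq)
    moreover have "q \<ge> norm a2 - norm b2" unfolding q_def by (rule norm_diff_ineq)
    moreover have "t \<le> norm a1 + norm b1" unfolding t_def by (rule norm_triangle_ineq)
    moreover have "0 \<le> norm a1" "0 \<le> norm b1" by simp_all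
    \<comment> \<open>\<open>p \<ge> 8 |b1| - |a1| / 8\<close> and
      \<open>q \<ge> 8 |a1| - |b1| / 8\<close>, so \<open>p + q\<close> is at least
      \<open>(8 - 1/8) t\<close>.\<close>
    ultimately have "4 * t \<le> p + q" using le by linarith
    then have "(4 * t)\<^sup>2 \<le> (p + q)\<^sup>2" by (intro power_mono) (simp_all add: t_def)
    moreover have "0 \<le> (p - q)\<^sup>2" by simp
    \<comment> \<open>From \<open>16 t^2 \<le> (p + q)^2 \<le> 2 (p^2 + q^2)\<close>.\<close>
    ultimately have "8 * t\<^sup>2 \<le> p\<^sup>2 + q\<^sup>2" by (simp add: power2_eq_square algebra_simps)
    then show ?thesis by (simp add: x1 x2 p_def q_def t_def)
  qed
  with N(1) have "orbit_convex A N" by (simp add: orbit_convex_def)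
  then show ?thesis ..
qed

subsection \<open>The spectrum\<close>

text \<open>The vectors \<open>X\<close> are compared with the true orbit through
  \<open>X n\<close>. The deviation \<open>D\<close> obeys the same recursion with source
  \<open>f\<close>, so over \<open>2 * N\<close> steps it is controlled by \<open>f\<close>; passing
  between \<open>X\<close> and the orbit costs a factor 2 at the middle and at the far end.\<close>

lemma inhomogeneous_orbit_convexity:
  assumes "M \<ge> 1" and M: "\<And>j x. (norm (schroedinger_cocycle E v j *v x))\<^sup>2 \<le> M * (norm x)\<^sup>2"
    and conv: "orbit_convex (schroedinger_cocycle E v) N"
    and f: "\<And>n. f n = \<psi> (n + 1) + \<psi> (n - 1) + v n * \<psi> n - E * \<psi> n"
  shows "4 * ((\<psi> (n + int N))\<^sup>2 + (\<psi> (n + int N - 1))\<^sup>2) \<le> (\<psi> n)\<^sup>2 + (\<psi> (n - 1))\<^sup>2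
    + 2 * ((\<psi> (n + 2 * int N))\<^sup>2 + (\<psi> (n + 2 * int N - 1))\<^sup>2)
    + 10 * (2 * M + 2) ^ (2 * N) * (\<Sum>i<2 * N. (f (n + int i))\<^sup>2)"
proof -
  define A where "A = schroedinger_cocycle E v"
  define X :: "int \<Rightarrow> real^2" where "X n = vector [\<psi> n, \<psi> (n - 1)]" for n
  have normX: "(norm (X n))\<^sup>2 = (\<psi> n)\<^sup>2 + (\<psi> (n - 1))\<^sup>2" for n
    by (simp add: norm_square_vec2 X_def)
  have X: "X (n + 1) = A n *v X n + vector [f n, 0]" for n
    unfolding A_def vec_eq_iff forall_2 vector_add_component schroedinger_cocycle_mult
    by (simp add: X_def f algebra_simps)
  \<comment> \<open>\<open>2 * M\<close> absorbs one step of the cocycle after splitting a squared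
    sum; the extra 2 absorbs the new source term.\<close>
  define c where "c = 2 * M + 2"
  have c: "c \<ge> 2" using assms(1) by (simp add: c_def)
  define D where "D k = X (n + int k) - forward_iterate A k n *v X n" for k
  have D: "(norm (D k))\<^sup>2 \<le> c ^ k * (\<Sum>i<k. (f (n + int i))\<^sup>2)" for k
  proof (induction k)
    case (Suc k)
    have "D (Suc k) = A (n + int k) *v D k + vector [f (n + int k), 0]"
      using X[of "n + int k"]
      by (simp add: D_def matrix_vector_mult_diff_distrib matrix_vector_mul_assoc algebra_simps)
    then have "(norm (D (Suc k)))\<^sup>2 \<le> 2 * (norm (A (n + int k) *v D k))\<^sup>2 + 2 * (f (n + int k))\<^sup>2"
      using norm_square_add_le[of "A (n + int k) *v D k" "vector [f (n + int k), 0]"]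
      by (simp add: norm_square_vec2[of "vector [f (n + int k), 0]"])
    also have "\<dots> \<le> 2 * (M * (norm (D k))\<^sup>2) + c * (f (n + int k))\<^sup>2"
      unfolding A_def using c by (intro add_mono mult_left_mono mult_right_mono M) auto
    also have "2 * (M * (norm (D k))\<^sup>2) \<le> c * (norm (D k))\<^sup>2"
      by (simp add: c_def algebra_simps)
    also have "c * (norm (D k))\<^sup>2 \<le> c * (c ^ k * (\<Sum>i<k. (f (n + int i))\<^sup>2))"
      using c by (intro mult_left_mono Suc) auto
    also have "c * (f (n + int k))\<^sup>2 \<le> c ^ Suc k * (f (n + int k))\<^sup>2"
      using c by (intro mult_right_mono self_le_power) auto
    finally show ?case by (simp add: algebra_simps)
  qed (simp add: D_def)
  define Fs where "Fs = c ^ (2 * N) * (\<Sum>i<2 * N. (f (n + int i))\<^sup>2)"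
  have "c ^ N * (\<Sum>i<N. (f (n + int i))\<^sup>2) \<le> Fs"
    unfolding Fs_def using c by (intro mult_mono power_increasing sum_mono2 sum_nonneg) auto
  with D[of N] D[of "2 * N"] have DF: "(norm (D N))\<^sup>2 \<le> Fs" "(norm (D (2 * N)))\<^sup>2 \<le> Fs"
    by (simp_all add: Fs_def)
  define y z where "y = forward_iterate A N n *v X n" and "z = forward_iterate A (2 * N) n *v X n"
  have 1: "8 * (norm y)\<^sup>2 \<le> (norm (X n))\<^sup>2 + (norm z)\<^sup>2"
    using conv unfolding orbit_convex_def y_def z_def A_def by blast
  have 2: "(norm (X (n + int N)))\<^sup>2 \<le> 2 * (norm y)\<^sup>2 + 2 * (norm (D N))\<^sup>2"
    using norm_square_add_le[of y "D N"] by (simp add: D_def y_def)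
  have 3: "(norm z)\<^sup>2 \<le> 2 * (norm (X (n + 2 * int N)))\<^sup>2 + 2 * (norm (D (2 * N)))\<^sup>2"
    using norm_square_add_le[of "X (n + 2 * int N)" "- D (2 * N)"] by (simp add: D_def z_def norm_minus_commute)
  \<comment> \<open>The 10 is 8 from the middle deviation plus 2 from the final one.\<close>
  have "4 * (norm (X (n + int N)))\<^sup>2 \<le> (norm (X n))\<^sup>2 + 2 * (norm (X (n + 2 * int N)))\<^sup>2 + 10 * Fs"
    using 1 2 3 DF by linarith
  then show ?thesis unfolding normX by (simp add: Fs_def c_def)
qed

lemma has_sum_finite_sum:
  fixes f :: "'i \<Rightarrow> 'a \<Rightarrow> real"
  shows "finite I \<Longrightarrow> (\<And>i. i \<in> I \<Longrightarrow> (f i has_sum S i) A) \<Longrightarrow> ((\<lambda>n. \<Sum>i\<in>I. f i n) has_sum (\<Sum>i\<in>I. S i)) A"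
  by (induction I rule: finite_induct) (auto intro!: has_sum_add)

text \<open>Summed over all sites, every translate of \<open>a\<close> contributes the same
  \<open>S\<close>. This gives \<open>8 S \<le> 6 S + 2 C N F\<close>, and the surplus on the left
  is the lower bound.\<close>

lemma orbit_convex_imp_bounded_below:
  assumes v: "bounded (range v)" and conv: "orbit_convex (schroedinger_cocycle E v) N"
  shows "bounded_below (shifted_op v (of_real E))"
proof -
  obtain M where M: "M \<ge> 1" "\<And>j x. (norm (schroedinger_cocycle E v j *v x))\<^sup>2 \<le> M * (norm x)\<^sup>2"
    using schroedinger_cocycle_bounded[OF v, of E] by metis
  define C where "C = 10 * (2 * M + 2) ^ (2 * N)"
  have C: "C > 0" using M(1) by (simp add: C_def)
  have "(ell2_norm \<psi>)\<^sup>2 \<le> (C * N) * (ell2_norm (shifted_op v (of_real E) \<psi>))\<^sup>2" if \<psi>: "\<psi> \<in> ell2" for \<psi>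
  proof -
    define f where "f = shifted_op v (of_real E) \<psi>"
    have f: "f \<in> ell2" unfolding f_def by (rule shifted_op_ell2[OF v \<psi>])
    define a where "a n = (cmod (\<psi> n))\<^sup>2" for n
    define g where "g n = (cmod (f n))\<^sup>2" for n
    define S where "S = (ell2_norm \<psi>)\<^sup>2"
    define F where "F = (ell2_norm f)\<^sup>2"
    have hs: "((\<lambda>n. (cmod (\<phi> (n + k)))\<^sup>2) has_sum (ell2_norm \<phi>)\<^sup>2) UNIV" if "\<phi> \<in> ell2" for \<phi> k
      using ell2_summable[OF ell2_translate[OF that]] ell2_shift(2)[of \<phi> k] has_sum_infsum
      by (metis (no_types, lifting) ell2_norm_square)
    have a: "((\<lambda>n. a (n + k)) has_sum S) UNIV" for k
      unfolding a_def S_def by (rule hs[OF \<psi>])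
    have g: "((\<lambda>n. g (n + k)) has_sum F) UNIV" for k
      unfolding g_def F_def by (rule hs[OF f])
    \<comment> \<open>\<open>v\<close> and \<open>E\<close> are real, so real and imaginary parts
      satisfy the real inequality separately and are added.\<close>
    have pw: "4 * (a (n + int N) + a (n + (int N - 1))) \<le> a (n + 0) + a (n + - 1)
      + 2 * (a (n + 2 * int N) + a (n + (2 * int N - 1))) + C * (\<Sum>i<2 * N. g (n + int i))" for n
    proof -
      have "Re (f m) = Re (\<psi> (m + 1)) + Re (\<psi> (m - 1)) + v m * Re (\<psi> m) - E * Re (\<psi> m)"
        "Im (f m) = Im (\<psi> (m + 1)) + Im (\<psi> (m - 1)) + v m * Im (\<psi> m) - E * Im (\<psi> m)" for m
        by (simp_all add: f_def shifted_op_def schroedinger_op_def)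
      from inhomogeneous_orbit_convexity[OF M conv this(1), of n] inhomogeneous_orbit_convexity[OF M conv this(2), of n]
      show ?thesis
        unfolding a_def g_def cmod_power2 C_def[symmetric] sum.distrib
        by (simp add: algebra_simps)
    qed
    have L: "((\<lambda>n. 4 * (a (n + int N) + a (n + (int N - 1)))) has_sum 4 * (S + S)) UNIV"
      by (intro has_sum_cmult_right has_sum_add a)
    have R: "((\<lambda>n. a (n + 0) + a (n + - 1) + 2 * (a (n + 2 * int N) + a (n + (2 * int N - 1)))
        + C * (\<Sum>i<2 * N. g (n + int i))) has_sum S + S + 2 * (S + S) + C * (\<Sum>i<2 * N. F)) UNIV"
      by (intro has_sum_cmult_right has_sum_add has_sum_finite_sum a g) simp
    have "4 * (S + S) \<le> S + S + 2 * (S + S) + C * (\<Sum>i<2 * N. F)"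
      by (rule has_sum_mono[OF L R]) (rule pw)
    then show ?thesis by (simp add: S_def F_def f_def)
  qed
  moreover have "C * N > 0" using C conv by (simp add: orbit_convex_def)
  ultimately show ?thesis unfolding bounded_below_def by blast
qed

theorem theorem3:
  fixes v :: "int \<Rightarrow> real"
  assumes "bounded (range v)"
  shows "ell2_spectrum (schroedinger_op v) =
    complex_of_real ` {E :: real. \<not> uniformly_hyperbolic (schroedinger_cocycle E v)}"
proof -
  have UH: "bounded_below (shifted_op v (of_real E)) \<longleftrightarrow> uniformly_hyperbolic (schroedinger_cocycle E v)" for E
    using bounded_below_imp_orbit_convex[of v E] orbit_convex_imp_bounded_below[OF assms, of E]
      orbit_convex_imp_uniformly_hyperbolic[OF assms, of E]
      uniformly_hyperbolic_imp_orbit_convex[of "schroedinger_cocycle E v", OF det_schroedinger_cocycle] by blast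
  \<comment> \<open>A real number is its own conjugate, so the condition on \<open>cnj z\<close> in
    the spectral criterion is trivial.\<close>
  have real: "complex_of_real E \<in> ell2_spectrum (schroedinger_op v)
      \<longleftrightarrow> \<not> uniformly_hyperbolic (schroedinger_cocycle E v)" for E
    using spectrum_iff_not_bounded_below[OF assms, of "of_real E"] UH by simp
  \<comment> \<open>For nonreal \<open>z\<close> both \<open>z\<close> and \<open>cnj z\<close>
    admit lower bounds, so \<open>z\<close> lies in the resolvent set.\<close>
  have "z = of_real (Re z)" if "z \<in> ell2_spectrum (schroedinger_op v)" for z
  proof (rule ccontr)
    assume "z \<noteq> of_real (Re z)"
    then have "Im z \<noteq> 0" "Im (cnj z) \<noteq> 0" by (auto simp: complex_eq_iff)
    then show False
      using that spectrum_iff_not_bounded_below[OF assms, of z] nonreal_bounded_below[OF assms] by blast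
  qed
  then show ?thesis using real by (auto simp: image_iff) metis
qed

end
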